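(* Let $\gamma=\begin{pmatrix}a&b\\c&d\end{pmatrix}\in SL(2,\mathbb Z)$, regarded modulo $\pm I_2$, and let $\gamma(F)=\{\frac{a\tau+b}{c\tau+d}:\tau\in F\}$. Then: (1) $E_6$ has no critical points in $\gamma(F)$ if $\frac{-d}{c}\in(0,1)\cup\{\infty\}$; (2) $E_6$ has exactly one critical point in $\gamma(F)$ if $\frac{-d}{c}\in(-\infty,0]\cup[1,+\infty)$. Moreover, this unique critical point lies on the boundary $\partial\gamma(F)=\gamma(\partial F)$ if and only if $\frac{-d}{c}\in\{0,1\}$.
   Context: $\mathbb H$ is the upper half-plane. $E_6(\tau)=\frac{27}{8\pi^6}g_3(\tau)$ where $g_3(\tau)=140\sum_{(m,n)\ne(0,0)}(m\tau+n)^{-6}$; a critical point is a zero of $E_6'$. $F=\{\tau\in\mathbb H:0\le\operatorname{Re}\tau\le1,\ |\tau|\ge1,\ |\tau-1|\ge1\}$ is the chosen fundamental domain of $SL(2,\mathbb Z)$. When $c=0$, $\frac{-d}{c}$ is interpreted as $\infty$. *)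

theory Defs
  imports "HOL-Analysis.Analysis"
begin

definition upper_half_plane :: "complex set" where
  "upper_half_plane = {\<tau>. Im \<tau> > 0}"

definition eisenstein_g3 :: "complex \<Rightarrow> complex" where
  "eisenstein_g3 \<tau> =
     140 * (\<Sum>\<^sub>\<infinity>(m, n)\<in>(UNIV :: (int \<times> int) set) - {(0, 0)}.
              1 / (of_int m * \<tau> + of_int n) ^ 6)"

definition eisenstein_E6 :: "complex \<Rightarrow> complex" where
  "eisenstein_E6 \<tau> = 27 / (8 * of_real pi ^ 6) * eisenstein_g3 \<tau>"

definition E6_critical_point :: "complex \<Rightarrow> bool" where
  "E6_critical_point \<tau> \<longleftrightarrow> \<tau> \<in> upper_half_plane \<and> deriv eisenstein_E6 \<tau> = 0"

definition fund_domain :: "complex set" where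
  "fund_domain =
     {\<tau> \<in> upper_half_plane. 0 \<le> Re \<tau> \<and> Re \<tau> \<le> 1 \<and> norm \<tau> \<ge> 1 \<and> norm (\<tau> - 1) \<ge> 1}"

definition modular_act :: "int \<Rightarrow> int \<Rightarrow> int \<Rightarrow> int \<Rightarrow> complex \<Rightarrow> complex" where
  "modular_act a b c d = moebius (of_int a) (of_int b) (of_int c) (of_int d)"

text \<open>Boundaries are taken relative to the upper half plane. This matters for the identity
  \<open>\<partial>\<gamma>(F) = \<gamma>(\<partial>F)\<close>: the frontier of \<open>\<gamma>(F)\<close> in the complex plane also contains the
  real cusp of \<open>\<gamma>(F)\<close> when \<open>c \<noteq> 0\<close>.\<close>

definition boundary_in_H :: "complex set \<Rightarrow> complex set" where
  "boundary_in_H S = (top_of_set upper_half_plane) frontier_of S"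

text \<open>The quotient \<open>-d/c\<close> with the convention that it is \<open>\<infinity>\<close> for \<open>c = 0\<close>, whatever the
  sign of \<open>d\<close>; the value \<open>-\<infinity>\<close> never occurs.\<close>

definition neg_d_over_c :: "int \<Rightarrow> int \<Rightarrow> ereal" where
  "neg_d_over_c c d = (if c = 0 then \<infinity> else ereal (- of_int d / of_int c))"

end

theory Submission
  imports Defs "HOL-Complex_Analysis.Complex_Analysis"
begin

text \<open>
  Differentiating \<open>E\<^sub>6(\<gamma>\<tau>) = (c\<tau> + d)\<^sup>6 E\<^sub>6(\<tau>)\<close> shows that \<open>\<gamma>\<tau>\<close> is a critical point iff
  \<open>c h(\<tau>) + d = 0\<close>, where \<open>h = \<tau> + 6 E\<^sub>6 / E\<^sub>6'\<close>; here \<open>E\<^sub>6'\<close> has no zeros on \<open>F\<close> by its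
  \<open>q\<close>-expansion. So the real values of \<open>h\<close> on \<open>F\<close> have to be determined, and by the symmetry
  \<open>h(1 - cnj \<tau>) = 1 - cnj (h \<tau>)\<close> the half \<open>K\<close> of \<open>F\<close> with \<open>Re \<tau> \<le> 1/2\<close> suffices.

  The \<open>q\<close>-expansion gives \<open>h = \<tau> + \<i>/(168\<pi>) (1/q - 570 + O(q))\<close> with explicit constants. Hence on
  \<open>K\<close> a real value can only be attained for \<open>1/6 < Re \<tau> < 1/3\<close>, where \<open>h\<close> is injective
  (as \<open>Im h' < 0\<close>) and \<open>Re h > 0\<close>. On \<open>|\<tau>| = 1\<close> one has \<open>|h| = 1\<close>, so there the only real value is 1.
  By the open mapping theorem and properness, the set of real values on \<open>K\<close> is therefore closed and,
  away from 1, open; it omits 0 and contains numbers greater than 1, so it is exactly \<open>[1,\<infinity>)\<close>,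
  and the value 1 is attained on the arc \<open>|\<tau>| = 1\<close>.
\<close>

section \<open>The Lipschitz formula of weight 6\<close>

text \<open>The matrix enters the critical point equation only through \<open>-d/c\<close>, so all
  images of \<open>F\<close> are treated at once, as a single counting problem on \<open>F\<close>.
  The obstacle is the extreme value 1: no numerical estimate can tell on which side of 1 a value
  near the arc lies. The exact relation \<open>|h| = 1\<close> decides that; it expresses that
  \<open>h\<close> is compatible with the reflection in the unit circle. Inequalities then serve
  only for coarse signs. That \<open>Im h\<close> changes sign along the arc can be read off from
  fixed points: \<open>E6 \<i> = 0\<close> gives \<open>h \<i> = \<i>\<close>, whereas at the corner
  \<open>e^(i pi / 3)\<close>, where \<open>E6\<close> does not vanish, \<open>h\<close> takes the
  conjugate value.

  The estimates have to reach down to that corner, where \<open>|q| = e^(-pi sqrt 3)\<close> is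
  about 1/231. There the bound for the remainder of \<open>h\<close> is comparable with the
  exponential term, which is why the first coefficients of each q-series are kept and the tails are
  bounded explicitly.\<close>

lemma DERIV_eq_on_open:
  fixes f g :: "complex \<Rightarrow> complex"
  assumes "open S" "z \<in> S" "\<And>w. w \<in> S \<Longrightarrow> f w = g w"
    and "(f has_field_derivative f') (at z)" "(g has_field_derivative g') (at z)"
  shows "f' = g'"
  by (metis DERIV_unique assms has_field_derivative_transform_within_open)

lemma not_Ints_imp_not_nonpos:
  fixes z :: complex
  assumes "z \<notin> \<int>"
  shows "z \<notin> \<int>\<^sub>\<le>\<^sub>0" "1 - z \<notin> \<int>\<^sub>\<le>\<^sub>0" "z \<noteq> 0" "1 - z \<noteq> 0" "sin (of_real pi * z) \<noteq> 0"
proof -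
  show "z \<notin> \<int>\<^sub>\<le>\<^sub>0" using assms by (meson nonpos_Ints_Int)
  show "1 - z \<notin> \<int>\<^sub>\<le>\<^sub>0"
  proof
    assume "1 - z \<in> \<int>\<^sub>\<le>\<^sub>0"
    then have "1 - (1 - z) \<in> \<int>" by (meson nonpos_Ints_Int Ints_1 Ints_diff)
    with assms show False by simp
  qed
  show "z \<noteq> 0" "1 - z \<noteq> 0" using assms by auto
  show "sin (of_real pi * z) \<noteq> 0"
  proof
    assume "sin (of_real pi * z) = 0"
    then obtain n :: int where "of_real pi * z = of_real (n * pi)"
      by (auto simp: sin_eq_0)
    then have "of_real pi * z = of_real pi * of_int n" by simp
    then have "z = of_int n" by (metis mult_left_cancel of_real_eq_0_iff pi_neq_zero)
    with assms show False by simp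
  qed
qed

section \<open>Reflection formulas for the polygamma functions\<close>

lemma open_compl_Ints: "open (- \<int> :: complex set)"
  using closed_Ints by blast

lemma has_field_derivative_cot_pi:
  fixes z :: complex
  assumes "z \<notin> \<int>"
  shows "((\<lambda>z. cot (of_real pi * z)) has_field_derivative
           - of_real pi * (1 + cot (of_real pi * z) ^ 2)) (at z)"
proof -
  have s: "sin (of_real pi * z) \<noteq> 0" using not_Ints_imp_not_nonpos[OF assms] by simp
  have "((\<lambda>z. cot (of_real pi * z)) has_field_derivative
           - inverse (sin (of_real pi * z) ^ 2) * of_real pi) (at z)"
    using s by (intro DERIV_chain2[where f=cot]) (auto intro!: derivative_eq_intros)
  moreover have "inverse (sin (of_real pi * z) ^ 2) = 1 + cot (of_real pi * z) ^ 2"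
    using s sin_cos_squared_add[of "of_real pi * z"] unfolding cot_def
    by (simp add: field_simps)
  ultimately show ?thesis by (simp add: mult.commute)
qed

text \<open>Logarithmic derivative of \<open>Gamma z * Gamma (1 - z) = pi / sin (pi z)\<close>. Five
  further derivatives of the result produce the sixth powers of the lattice sum.\<close>

lemma Digamma_reflection:
  fixes z :: complex
  assumes "z \<notin> \<int>"
  shows "Digamma z - Digamma (1 - z) = - of_real pi * cot (of_real pi * z)"
proof -
  note n = not_Ints_imp_not_nonpos[OF assms]
  define L where "L z = Gamma z * Gamma (1 - z)" for z :: complex
  have G: "Gamma z \<noteq> 0" "Gamma (1 - z) \<noteq> 0" using n by (auto simp: Gamma_eq_zero_iff)
  have L1: "(L has_field_derivative L z * (Digamma z - Digamma (1 - z))) (at z)"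
    unfolding L_def using n
    by (auto intro!: derivative_eq_intros simp: algebra_simps)
  have L2: "((\<lambda>z. of_real pi / sin (of_real pi * z)) has_field_derivative
      - of_real pi * cos (of_real pi * z) * of_real pi / sin (of_real pi * z) ^ 2) (at z)"
    using n by (auto intro!: derivative_eq_intros simp: power2_eq_square)
  have "L z * (Digamma z - Digamma (1 - z)) =
      - of_real pi * cos (of_real pi * z) * of_real pi / sin (of_real pi * z) ^ 2"
    by (rule DERIV_eq_on_open[OF open_UNIV UNIV_I _ L1 L2]) (simp add: L_def Gamma_reflection_complex)
  moreover have "L z = of_real pi / sin (of_real pi * z)"
    by (auto simp: L_def Gamma_reflection_complex)
  ultimately have "(Digamma z - Digamma (1 - z)) * (of_real pi / sin (of_real pi * z)) =
      - of_real pi * cot (of_real pi * z) * (of_real pi / sin (of_real pi * z))"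
    by (simp add: cot_def power2_eq_square mult_ac)
  then show ?thesis using n(5) by (subst (asm) mult_right_cancel) auto
qed

text \<open>The inner derivative of \<open>1 - z\<close> flips the sign \<open>s\<close>. Since the
  derivative of \<open>cot (pi z)\<close> is again a polynomial in \<open>cot (pi z)\<close>, the
  right-hand side stays polynomial at every step.\<close>

lemma Polygamma_reflection_step:
  fixes z :: complex and p dp :: "complex \<Rightarrow> complex"
  assumes "\<And>z. z \<notin> \<int> \<Longrightarrow> Polygamma n z + s * Polygamma n (1 - z) = p (cot (of_real pi * z))"
    and "\<And>t. (p has_field_derivative dp t) (at t)" and "z \<notin> \<int>"
  shows "Polygamma (Suc n) z + (- s) * Polygamma (Suc n) (1 - z) =
           dp (cot (of_real pi * z)) * (- of_real pi * (1 + cot (of_real pi * z) ^ 2))"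
proof (rule DERIV_eq_on_open[of "-\<int>" z])
  note n = not_Ints_imp_not_nonpos[OF assms(3)]
  show "((\<lambda>z. Polygamma n z + s * Polygamma n (1 - z)) has_field_derivative
          Polygamma (Suc n) z + (- s) * Polygamma (Suc n) (1 - z)) (at z)"
    using n by (auto intro!: derivative_eq_intros)
  show "((\<lambda>z. p (cot (of_real pi * z))) has_field_derivative
           dp (cot (of_real pi * z)) * (- of_real pi * (1 + cot (of_real pi * z) ^ 2))) (at z)"
    by (rule DERIV_chain2[OF assms(2) has_field_derivative_cot_pi[OF assms(3)]])
qed (use assms open_compl_Ints in auto)

lemma Polygamma_5_reflection:
  fixes z :: complex
  assumes "z \<notin> \<int>"
  defines "t \<equiv> cot (of_real pi * z)"
  shows "Polygamma 5 z + Polygamma 5 (1 - z) =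
    8 * of_real pi ^ 6 * (1 + t ^ 2) * (2 + 15 * t ^ 2 + 15 * t ^ 4)"
proof -
  let ?p = "of_real pi :: complex"
  have 0: "Polygamma 0 z + (-1) * Polygamma 0 (1 - z) = (\<lambda>t. - ?p * t) (cot (?p * z))"
    if "z \<notin> \<int>" for z using Digamma_reflection[OF that] by simp
  have 1: "Polygamma 1 z + 1 * Polygamma 1 (1 - z) = (\<lambda>t. ?p^2 * (1 + t^2)) (cot (?p * z))"
    if "z \<notin> \<int>" for z
  proof -
    have "Polygamma (Suc 0) z + (-(-1)) * Polygamma (Suc 0) (1 - z) =
        (\<lambda>t. - ?p) (cot (?p * z)) * (- ?p * (1 + cot (?p * z) ^ 2))"
      by (rule Polygamma_reflection_step[OF 0 _ that]) (auto intro!: derivative_eq_intros)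
    then show ?thesis by (simp add: algebra_simps power2_eq_square)
  qed
  have 2: "Polygamma 2 z + (-1) * Polygamma 2 (1 - z) = (\<lambda>t. -2 * ?p^3 * (t + t^3)) (cot (?p * z))"
    if "z \<notin> \<int>" for z
  proof -
    have "Polygamma (Suc 1) z + (-1) * Polygamma (Suc 1) (1 - z) =
        (\<lambda>t. ?p^2 * (2 * t)) (cot (?p * z)) * (- ?p * (1 + cot (?p * z) ^ 2))"
      by (rule Polygamma_reflection_step[OF 1 _ that]) (auto intro!: derivative_eq_intros)
    also have "Suc 1 = 2" by simp
    finally show ?thesis by (simp add: algebra_simps power2_eq_square power3_eq_cube)
  qed
  have 3: "Polygamma 3 z + 1 * Polygamma 3 (1 - z) =
      (\<lambda>t. 2 * ?p^4 * (1 + 4*t^2 + 3*t^4)) (cot (?p * z))"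
    if "z \<notin> \<int>" for z
  proof -
    have "Polygamma (Suc 2) z + (-(-1)) * Polygamma (Suc 2) (1 - z) =
        (\<lambda>t. -2 * ?p^3 * (1 + 3*t^2)) (cot (?p * z)) * (- ?p * (1 + cot (?p * z) ^ 2))"
      by (rule Polygamma_reflection_step[OF 2 _ that]) (auto intro!: derivative_eq_intros)
    also have "Suc 2 = 3" by simp
    finally show ?thesis by (simp add: algebra_simps eval_nat_numeral)
  qed
  have 4: "Polygamma 4 z + (-1) * Polygamma 4 (1 - z) =
      (\<lambda>t. -8 * ?p^5 * (2*t + 5*t^3 + 3*t^5)) (cot (?p * z))"
    if "z \<notin> \<int>" for z
  proof -
    have "Polygamma (Suc 3) z + (-1) * Polygamma (Suc 3) (1 - z) =
        (\<lambda>t. 2 * ?p^4 * (8*t + 12*t^3)) (cot (?p * z)) * (- ?p * (1 + cot (?p * z) ^ 2))"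
      by (rule Polygamma_reflection_step[OF 3 _ that]) (auto intro!: derivative_eq_intros)
    also have "Suc 3 = 4" by simp
    finally show ?thesis by (simp add: algebra_simps eval_nat_numeral)
  qed
  have "Polygamma (Suc 4) z + (-(-1)) * Polygamma (Suc 4) (1 - z) =
        (\<lambda>t. -8 * ?p^5 * (2 + 15*t^2 + 15*t^4)) (cot (?p * z)) * (- ?p * (1 + cot (?p * z) ^ 2))"
    by (rule Polygamma_reflection_step[OF 4 _ assms(1)]) (auto intro!: derivative_eq_intros)
  also have "Suc 4 = 5" by simp
  finally show ?thesis by (simp add: algebra_simps eval_nat_numeral t_def)
qed

text \<open>\<open>Polygamma 5 z\<close> is 5! = 120 times the sum over \<open>n \<ge> 0\<close>;
  the negative integers contribute the same series at \<open>1 - z\<close>.\<close>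

lemma has_sum_inverse_power6_int:
  fixes z :: complex
  assumes "z \<notin> \<int>"
  shows "((\<lambda>n::int. 1 / (z + of_int n) ^ 6) has_sum (Polygamma 5 z + Polygamma 5 (1 - z)) / 120) UNIV"
proof -
  note n = not_Ints_imp_not_nonpos[OF assms]
  have *: "((\<lambda>k::nat. 1 / (w + of_nat k) ^ 6) has_sum Polygamma 5 w / 120) UNIV"
    if "w \<noteq> 0" for w :: complex
  proof -
    have s: "summable (\<lambda>k. norm (inverse ((w + of_nat k) ^ 6)))"
    proof (rule summable_comparison_test_ev)
      \<comment> \<open>Here \<open>64 = 2 ^ 6\<close>: as soon as
        \<open>k \<ge> 2 * norm w\<close>, the distance of \<open>w\<close> from \<open>-k\<close>
        is at least \<open>k / 2\<close>.\<close>
      show "summable (\<lambda>k::nat. 64 * inverse (real k ^ 6))"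
        by (intro summable_mult inverse_power_summable) auto
      show "\<forall>\<^sub>F k in sequentially. norm (norm (inverse ((w + of_nat k) ^ 6))) \<le> 64 * inverse (real k ^ 6)"
        using eventually_ge_at_top[of "nat \<lceil>2 * norm w\<rceil> + 1"]
      proof eventually_elim
        case (elim k)
        have k: "real k > 0" "real k \<ge> 2 * norm w" using elim by linarith+
        have "norm (w + of_nat k) \<ge> real k / 2"
          using norm_diff_ineq[of "of_nat k" w] k by (simp add: add.commute)
        then have "(real k / 2) ^ 6 \<le> norm (w + of_nat k) ^ 6"
          by (intro power_mono) auto
        then have "inverse (norm (w + of_nat k) ^ 6) \<le> inverse ((real k / 2) ^ 6)"
          using k by (intro le_imp_inverse_le) auto
        then show ?case by (simp add: norm_inverse norm_power norm_divide power_divide inverse_eq_divide)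
      qed
    qed
    have "(\<lambda>k. inverse ((w + of_nat k) ^ 6)) sums (Polygamma 5 w / 120)"
      using summable_sums[OF Polygamma_converges'[OF that, of 6]]
      by (simp add: Polygamma_def fact_numeral)
    from norm_summable_imp_has_sum[OF s this] show ?thesis
      by (simp add: inverse_eq_divide)
  qed
  have a: "((\<lambda>n::int. 1 / (z + of_int n) ^ 6) has_sum Polygamma 5 z / 120) (range int)"
    using has_sum_reindex[of int UNIV "\<lambda>n::int. 1 / (z + of_int n) ^ 6"] *[OF n(3)]
    by (simp add: o_def inj_on_def)
  \<comment> \<open>Enumerates the negative integers; \<open>1 - z + k\<close> is the negative of
    \<open>z + h k\<close>, and the even exponent removes the sign.\<close>
  define h where "h k = - int k - 1" for k
  have e: "1 / (1 - z + of_nat k) ^ 6 = 1 / (z + of_int (h k)) ^ 6" for k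
  proof -
    have "1 - z + of_nat k = - (z + of_int (h k))" by (simp add: h_def)
    then show ?thesis by (metis even_numeral power_minus_even)
  qed
  have b: "((\<lambda>n::int. 1 / (z + of_int n) ^ 6) has_sum Polygamma 5 (1 - z) / 120) (range h)"
    using has_sum_reindex[of h UNIV "\<lambda>n::int. 1 / (z + of_int n) ^ 6"] *[OF n(4)] e
    by (simp add: o_def inj_on_def h_def)
  have "range int \<inter> range h = {}" by (auto simp: h_def)
  moreover have "range int \<union> range h = UNIV"
  proof -
    have "x \<in> range int \<union> range h" for x
    proof (cases "x \<ge> 0")
      case True then have "x = int (nat x)" by simp
      then show ?thesis by blast
    next
      case False then have "x = h (nat (- x - 1))" by (simp add: h_def)
      then show ?thesis by blast
    qed
    then show ?thesis by blast
  qed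
  ultimately show ?thesis using has_sum_Un_disjoint[OF a b] by (simp add: add_divide_distrib)
qed

section \<open>Power sums in q and the nome\<close>

lemma power_series_step:
  fixes c :: "nat \<Rightarrow> complex" and g :: "complex \<Rightarrow> complex"
  assumes "\<And>q. norm q < 1 \<Longrightarrow> (\<lambda>k. c k * q ^ k) sums g q"
    and "norm q < 1" and "(g has_field_derivative g') (at q)"
  shows "(\<lambda>k. of_nat k * c k * q ^ k) sums (q * g')"
proof -
  have "(\<lambda>n. diffs c n * q ^ n) sums g'"
    by (rule termdiffs_sums_strong[OF assms(1) assms(3)]) (use assms in auto)
  then have "(\<lambda>n. q * (diffs c n * q ^ n)) sums (q * g')" by (rule sums_mult)
  then have "(\<lambda>n. of_nat (Suc n) * c (Suc n) * q ^ Suc n) sums (q * g')"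
    by (simp add: diffs_def algebra_simps del: of_nat_Suc)
  then show ?thesis by (subst (asm) sums_Suc_iff) simp
qed

text \<open>Five applications of \<open>q d/dq\<close> to the geometric series. The numerators are
  the Eulerian polynomials, the last one having the coefficients 1, 26, 66, 26, 1.\<close>

lemma sums_fifth_powers:
  fixes q :: complex
  assumes "norm q < 1"
  shows "(\<lambda>k. of_nat k ^ 5 * q ^ k) sums
    (q * (1 + 26 * q + 66 * q^2 + 26 * q^3 + q^4) / (1 - q) ^ 6)"
proof -
  have ne: "1 - q \<noteq> 0" if "norm q < 1" for q :: complex using that by auto
  have 0: "(\<lambda>k. of_nat k ^ 0 * q ^ k) sums (1 / (1 - q))" if "norm q < 1" for q :: complex
    using geometric_sums[OF that] by simp
  have 1: "(\<lambda>k. of_nat k ^ 1 * q ^ k) sums (q / (1 - q)^2)" if "norm q < 1" for q :: complex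
  proof -
    have "((\<lambda>q. 1 / (1 - q)) has_field_derivative 1 / (1 - q)^2) (at q)"
      using ne[OF that]
      by (auto intro!: derivative_eq_intros simp: power2_eq_square)
    from power_series_step[OF 0 that this] show ?thesis by simp
  qed
  have 2: "(\<lambda>k. of_nat k ^ 2 * q ^ k) sums (q * (1 + q) / (1 - q)^3)" if "norm q < 1" for q :: complex
  proof -
    have "((\<lambda>q. q / (1 - q)^2) has_field_derivative (1 + q) / (1 - q)^3) (at q)"
      using ne[OF that]
      by (auto intro!: derivative_eq_intros) (simp add: divide_simps; simp add: algebra_simps eval_nat_numeral)
    from power_series_step[OF 1 that this] show ?thesis by (simp add: power2_eq_square)
  qed
  have 3: "(\<lambda>k. of_nat k ^ 3 * q ^ k) sums (q * (1 + 4 * q + q^2) / (1 - q)^4)" if "norm q < 1" for q :: complex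
  proof -
    have "((\<lambda>q. q * (1 + q) / (1 - q)^3) has_field_derivative (1 + 4 * q + q^2) / (1 - q)^4) (at q)"
      using ne[OF that]
      by (auto intro!: derivative_eq_intros) (simp add: divide_simps; simp add: algebra_simps eval_nat_numeral)
    from power_series_step[OF 2 that this] show ?thesis by (simp add: eval_nat_numeral mult_ac)
  qed
  have 4: "(\<lambda>k. of_nat k ^ 4 * q ^ k) sums (q * (1 + 11 * q + 11 * q^2 + q^3) / (1 - q)^5)"
    if "norm q < 1" for q :: complex
  proof -
    have "((\<lambda>q. q * (1 + 4 * q + q^2) / (1 - q)^4) has_field_derivative
        (1 + 11 * q + 11 * q^2 + q^3) / (1 - q)^5) (at q)"
      using ne[OF that]
      by (auto intro!: derivative_eq_intros) (simp add: divide_simps; simp add: algebra_simps eval_nat_numeral)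
    from power_series_step[OF 3 that this] show ?thesis by (simp add: eval_nat_numeral mult_ac)
  qed
  have "((\<lambda>q. q * (1 + 11 * q + 11 * q^2 + q^3) / (1 - q)^5) has_field_derivative
      (1 + 26 * q + 66 * q^2 + 26 * q^3 + q^4) / (1 - q) ^ 6) (at q)"
    using ne[OF assms]
    by (auto intro!: derivative_eq_intros) (simp add: divide_simps; simp add: algebra_simps eval_nat_numeral)
  from power_series_step[OF 4 assms this] show ?thesis by (simp add: eval_nat_numeral mult_ac)
qed

definition nome :: "complex \<Rightarrow> complex" where
  "nome z = exp (2 * of_real pi * \<i> * z)"

lemma norm_nome: "norm (nome z) = exp (- 2 * pi * Im z)"
  by (simp add: nome_def)

lemma norm_nome_less_1: "Im z > 0 \<Longrightarrow> norm (nome z) < 1"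
  by (simp add: norm_nome)

text \<open>Written in \<open>q\<close>, the polynomial in the cotangent becomes a multiple of the
  Eulerian quotient for fifth powers. The constant is \<open>(2 pi i)^6 / 5!\<close>.\<close>

lemma lipschitz_formula_6:
  assumes "Im z > 0"
  shows "((\<lambda>n::int. 1 / (z + of_int n) ^ 6) has_sum
     - (8 * of_real pi ^ 6 / 15) * (\<Sum>k. of_nat k ^ 5 * nome z ^ k)) UNIV"
proof -
  define q where "q = nome z"
  define t where "t = cot (of_real pi * z)"
  have z: "z \<notin> \<int>" using assms by (auto elim!: Ints_cases)
  have q1: "q - 1 \<noteq> 0" using norm_nome_less_1[OF assms] by (auto simp: q_def)
  \<comment> \<open>A square root of the nome: sine and cosine of \<open>pi z\<close> are Laurent
    polynomials in \<open>u\<close>, and their quotient depends on \<open>u ^ 2 = q\<close>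
    only.\<close>
  define u where "u = exp (\<i> * (of_real pi * z))"
  have u: "u \<noteq> 0" "u ^ 2 = q" "exp (- (\<i> * (of_real pi * z))) = inverse u"
    by (auto simp: u_def q_def nome_def exp_minus mult_ac simp flip: exp_double)
  have qu: "u * u - 1 \<noteq> 0" using u q1 by (simp add: power2_eq_square)
  have t: "t = \<i> * (q + 1) / (q - 1)"
    unfolding t_def cot_def cos_exp_eq sin_exp_eq u(3) u_def[symmetric] u(2)[symmetric] power2_eq_square
    using u qu by (simp add: field_simps)
  have "(1 + t ^ 2) * (2 + 15 * t ^ 2 + 15 * t ^ 4) = 
     - 8 * (q * (1 + 26 * q + 66 * q^2 + 26 * q^3 + q^4) / (1 - q) ^ 6)"
  proof -
    have t2: "t ^ 2 = - ((q + 1)^2 / (q - 1)^2)" by (simp add: t power_mult_distrib power_divide)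
    have t4: "t ^ 4 = (q + 1)^4 / (q - 1)^4"
      using arg_cong[OF t2, of "\<lambda>x. x^2"] by (simp add: power_divide)
    have "(1 - q) ^ 6 = (q - 1) ^ 6" by (metis minus_diff_eq even_numeral power_minus_even)
    then show ?thesis unfolding t2 t4 using q1
      by (simp add: divide_simps; simp add: algebra_simps eval_nat_numeral)
  qed
  also have "q * (1 + 26 * q + 66 * q^2 + 26 * q^3 + q^4) / (1 - q) ^ 6 = (\<Sum>k. of_nat k ^ 5 * q ^ k)"
    using sums_fifth_powers[OF norm_nome_less_1[OF assms]] by (simp add: sums_iff q_def)
  finally have *: "(1 + t ^ 2) * (2 + 15 * t ^ 2 + 15 * t ^ 4) = - 8 * (\<Sum>k. of_nat k ^ 5 * q ^ k)" .
  have "(Polygamma 5 z + Polygamma 5 (1 - z)) / 120 =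
     8 * of_real pi ^ 6 * ((1 + t ^ 2) * (2 + 15 * t ^ 2 + 15 * t ^ 4)) / 120"
    unfolding Polygamma_5_reflection[OF z] t_def by (simp add: mult.assoc)
  also have "\<dots> = - (8 * of_real pi ^ 6 / 15) * (\<Sum>k. of_nat k ^ 5 * q ^ k)"
    unfolding * by simp
  finally show ?thesis using has_sum_inverse_power6_int[OF z] by (simp only: q_def)
qed

text \<open>The value at \<open>z = 1/2\<close>, where the cotangent vanishes; it yields \<open>\<zeta>(6)\<close> below.\<close>

lemma has_sum_inverse_odd_power6: 
  "((\<lambda>n::int. 1 / (1 + 2 * of_int n) ^ 6) has_sum (complex_of_real pi ^ 6 / 480)) UNIV"
proof -
  have h: "(1/2::complex) \<notin> \<int>" using fraction_not_in_Ints[where 'a = complex, of 2 1] by simp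
  have "cot (of_real pi * (1/2::complex)) = 0"
    using cot_of_real[of "pi/2", where 'a=complex] by (simp add: cot_def)
  then have "((\<lambda>n::int. 1 / ((1/2) + of_int n) ^ 6) has_sum (2 * complex_of_real pi ^ 6 / 15)) UNIV"
    using has_sum_inverse_power6_int[OF h] Polygamma_5_reflection[OF h] by simp
  then have "((\<lambda>n::int. (1/64) * (1 / ((1/2) + of_int n) ^ 6)) has_sum ((1/64) * (2 * complex_of_real pi ^ 6 / 15))) UNIV"
    by (rule has_sum_cmult_right)
  moreover have "(1/64) * (1 / ((1/2) + of_int n) ^ 6) = 1 / (1 + 2 * of_int n :: complex) ^ 6" for n :: int
  proof -
    have "(1 + 2 * of_int n :: complex) = 2 * ((1/2) + of_int n)" by simp
    then show ?thesis by (simp only: power_mult_distrib) simp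
  qed
  ultimately show ?thesis by simp
qed

section \<open>The q-expansion\<close>

lemma summable_on_inverse_cube_int:
  "(\<lambda>m::int. 1 / (1 + \<bar>real_of_int m\<bar>) ^ 3) summable_on UNIV"
proof -
  have s: "summable (\<lambda>n::nat. 1 / (1 + real n) ^ 3)"
    using inverse_power_summable[of 3, where 'a = real] summable_Suc_iff[of "\<lambda>n. inverse (real n ^ 3)"]
    by (simp add: inverse_eq_divide add.commute)
  then have n: "(\<lambda>n::nat. 1 / (1 + real n) ^ 3) summable_on UNIV"
    by (subst summable_on_UNIV_nonneg_real_iff) auto
  have a: "(\<lambda>m::int. 1 / (1 + \<bar>real_of_int m\<bar>) ^ 3) summable_on range int"
    using summable_on_reindex[of int UNIV "\<lambda>m::int. 1 / (1 + \<bar>real_of_int m\<bar>) ^ 3"] n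
    by (simp add: o_def inj_on_def)
  have b: "(\<lambda>m::int. 1 / (1 + \<bar>real_of_int m\<bar>) ^ 3) summable_on range (\<lambda>k. - int k)"
    using summable_on_reindex[of "\<lambda>k. - int k" UNIV "\<lambda>m::int. 1 / (1 + \<bar>real_of_int m\<bar>) ^ 3"] n
    by (simp add: o_def inj_on_def)
  have "x \<in> range int \<union> range (\<lambda>k. - int k)" for x
    by (cases x rule: int_cases2) auto
  then have "UNIV = range int \<union> range (\<lambda>k. - int k)" by blast
  then show ?thesis using summable_on_union[OF a b] by simp
qed

lemma summable_on_Times_nonneg:
  fixes f :: "'a \<Rightarrow> real" and g :: "'b \<Rightarrow> real"
  assumes "f summable_on A" "g summable_on B" "\<And>x. x \<in> A \<Longrightarrow> f x \<ge> 0" "\<And>y. y \<in> B \<Longrightarrow> g y \<ge> 0"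
  shows "(\<lambda>(x, y). f x * g y) summable_on A \<times> B"
proof (rule summable_on_SigmaI)
  show "((\<lambda>y. case (x, y) of (x, y) \<Rightarrow> f x * g y) has_sum f x * infsum g B) B" if "x \<in> A" for x
    using has_sum_cmult_right[OF has_sum_infsum[OF assms(2)]] by simp
  show "(\<lambda>x. f x * infsum g B) summable_on A"
    by (rule summable_on_cmult_left[OF assms(1)])
qed (use assms in auto)

text \<open>The imaginary part controls \<open>m\<close>, and the triangle inequality then controls
  \<open>n\<close>. One of the two integers has absolute value at least 1, so the added 1 costs only
  the factor 2; it keeps the comparison series free of zero denominators on the axes.\<close>

lemma norm_lattice_point_ge:
  fixes m n :: int
  assumes "Im \<tau> > 0" "(m, n) \<noteq> (0, 0)"
  defines "C \<equiv> 1 + (1 + norm \<tau>) / Im \<tau>"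
  shows "1 + \<bar>real_of_int m\<bar> \<le> 2 * C * norm (of_int m * \<tau> + of_int n)"
    and "1 + \<bar>real_of_int n\<bar> \<le> 2 * C * norm (of_int m * \<tau> + of_int n)"
proof -
  define N where "N = norm (of_int m * \<tau> + of_int n)"
  have "\<bar>real_of_int m\<bar> * Im \<tau> = \<bar>Im (of_int m * \<tau> + of_int n)\<bar>" using assms by (simp add: abs_mult)
  also have "\<dots> \<le> N" unfolding N_def by (rule abs_Im_le_cmod)
  finally have m: "\<bar>real_of_int m\<bar> \<le> N / Im \<tau>" using assms by (simp add: field_simps)
  have "\<bar>real_of_int n\<bar> = norm ((of_int m * \<tau> + of_int n) - of_int m * \<tau>)" by simp
  also have "\<dots> \<le> N + \<bar>real_of_int m\<bar> * norm \<tau>"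
    unfolding N_def by (rule order_trans[OF norm_triangle_ineq4]) (simp add: norm_mult)
  also have "\<dots> \<le> N + N / Im \<tau> * norm \<tau>" using m by (intro add_left_mono mult_right_mono) auto
  finally have n: "\<bar>real_of_int n\<bar> \<le> N + N / Im \<tau> * norm \<tau>" .
  have C: "C * N = N + N / Im \<tau> + N / Im \<tau> * norm \<tau>" using assms by (simp add: C_def field_simps)
  have N: "N \<ge> 0" by (simp add: N_def)
  have p: "N / Im \<tau> \<ge> 0" "N / Im \<tau> * norm \<tau> \<ge> 0" using N assms by auto
  have mC: "\<bar>real_of_int m\<bar> \<le> C * N" and nC: "\<bar>real_of_int n\<bar> \<le> C * N"
    using m n p N unfolding C by linarith+
  have "\<bar>real_of_int m\<bar> \<ge> 1 \<or> \<bar>real_of_int n\<bar> \<ge> 1" using assms(2) by auto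
  then have "1 \<le> C * N" using mC nC by linarith
  with mC nC show "1 + \<bar>real_of_int m\<bar> \<le> 2 * C * norm (of_int m * \<tau> + of_int n)"
    "1 + \<bar>real_of_int n\<bar> \<le> 2 * C * norm (of_int m * \<tau> + of_int n)"
    unfolding N_def[symmetric] by linarith+
qed

text \<open>Three of the six factors are spent on \<open>m\<close> and three on \<open>n\<close>, so
  that the double series is dominated by a product of two convergent single series.\<close>

lemma lattice_sum_summable:
  assumes "Im \<tau> > 0"
  shows "(\<lambda>(m, n). 1 / (of_int m * \<tau> + of_int n) ^ 6) summable_on (UNIV :: (int \<times> int) set) - {(0, 0)}"
proof -
  define C where "C = 2 * (1 + (1 + norm \<tau>) / Im \<tau>)"
  have C: "C > 0" using assms by (auto simp: C_def intro!: add_pos_nonneg)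
  let ?g = "\<lambda>m::int. 1 / (1 + \<bar>real_of_int m\<bar>) ^ 3"
  have "(\<lambda>(m, n). ?g m * ?g n) summable_on UNIV \<times> UNIV"
    by (intro summable_on_Times_nonneg summable_on_inverse_cube_int) auto
  then have "(\<lambda>(m, n). ?g m * ?g n) summable_on UNIV - {(0, 0)}"
    by (rule summable_on_subset) auto
  then have "(\<lambda>x. C ^ 6 * (case x of (m, n) \<Rightarrow> ?g m * ?g n)) summable_on UNIV - {(0, 0)}"
    by (rule summable_on_cmult_right)
  then have g: "(\<lambda>(m, n). C ^ 6 * (?g m * ?g n)) summable_on UNIV - {(0, 0)}"
    by (simp add: case_prod_unfold)
  have le: "norm (case x of (m, n) \<Rightarrow> 1 / (of_int m * \<tau> + of_int n) ^ 6)
      \<le> (case x of (m, n) \<Rightarrow> C ^ 6 * (?g m * ?g n))" if x: "x \<in> UNIV - {(0, 0)}" for x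
  proof -
    obtain m n where mn: "x = (m, n)" by fastforce
    define N where "N = norm (of_int m * \<tau> + of_int n)"
    have le: "1 + \<bar>real_of_int m\<bar> \<le> C * N" "1 + \<bar>real_of_int n\<bar> \<le> C * N"
      using norm_lattice_point_ge[OF assms, of m n] x unfolding mn N_def C_def by auto
    then have pos: "0 < C * N" by linarith
    then have N: "N > 0" using C zero_less_mult_pos by blast
    have "(1 + \<bar>real_of_int m\<bar>) ^ 3 * (1 + \<bar>real_of_int n\<bar>) ^ 3 \<le> (C * N) ^ 3 * (C * N) ^ 3"
      using le pos by (intro mult_mono power_mono) auto
    also have "\<dots> = C ^ 6 * N ^ 6" by (simp add: algebra_simps eval_nat_numeral)
    finally have "1 / N ^ 6 \<le> C ^ 6 * (?g m * ?g n)"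
      using N by (simp add: field_simps)
    then show ?thesis
      by (simp add: mn norm_divide norm_power N_def)
  qed
  show ?thesis
    by (rule abs_summable_summable, rule Infinite_Sum.abs_summable_on_comparison_test'[OF g le])
qed

text \<open>The value is \<open>2 zeta(6)\<close>. Splitting by parity gives the equation
  \<open>Z = Z / 64 + pi ^ 6 / 480\<close>, whose last term is the known sum over the odd
  integers.\<close>

lemma has_sum_inverse_power6_nonzero_int:
  "((\<lambda>n::int. 1 / of_int n ^ 6) has_sum (2 * complex_of_real pi ^ 6 / 945)) (- {0})"
proof -
  let ?f = "\<lambda>n::int. 1 / of_int n ^ 6 :: complex"
  \<comment> \<open>The row \<open>m = 0\<close> of the lattice sum at \<open>\<i>\<close>; any
    point of the upper half-plane would give the same row.\<close>
  have "(\<lambda>n::int. 1 / (of_int 0 * \<i> + of_int n) ^ 6 :: complex) summable_on - {0}"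
    by (rule summable_on_SigmaD1[where A = UNIV and B = "\<lambda>m. if m = 0 then - {0} else UNIV" and x = 0, simplified])
       (rule summable_on_subset[OF lattice_sum_summable[of \<i>, simplified]], auto split: if_splits)
  then have "?f summable_on - {0}" by simp
  then obtain Z where Z: "(?f has_sum Z) (- {0})" by (auto simp: summable_on_def)
  have "((\<lambda>n. ?f (2 * n)) has_sum (1 / 64) * Z) (- {0})"
    using has_sum_cmult_right[OF Z, of "1/64"] by (simp add: power_mult_distrib)
  then have e: "(?f has_sum (1 / 64) * Z) ((*) 2 ` (- {0}))"
    by (subst has_sum_reindex) (auto simp: inj_on_def o_def)
  have o: "(?f has_sum (of_real pi ^ 6 / 480)) (range (\<lambda>n. 1 + 2 * n))"
    using has_sum_inverse_odd_power6
    by (subst has_sum_reindex) (auto simp: inj_on_def o_def)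
  have "(*) 2 ` (- {0}) \<inter> range (\<lambda>n::int. 1 + 2 * n) = {}" by (auto, presburger)
  moreover have "(*) 2 ` (- {0}) \<union> range (\<lambda>n::int. 1 + 2 * n) = - {0}"
  proof -
    have "x \<in> (*) 2 ` (- {0}) \<union> range (\<lambda>n::int. 1 + 2 * n)" if "x \<noteq> 0" for x :: int
    proof (cases "even x")
      case True then obtain y where "x = 2 * y" by (auto elim: evenE)
      then show ?thesis using that by auto
    next
      case False then obtain y where "x = 2 * y + 1" by (auto elim: oddE)
      then show ?thesis by auto
    qed
    moreover have "1 + 2 * n \<noteq> 0" for n :: int by presburger
    ultimately show ?thesis by auto
  qed
  ultimately have "(?f has_sum ((1 / 64) * Z + of_real pi ^ 6 / 480)) (- {0})"
    using has_sum_Un_disjoint[OF e o] by simp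
  with Z have "Z = (1 / 64) * Z + of_real pi ^ 6 / 480" using has_sum_unique by blast
  then have "Z = 2 * of_real pi ^ 6 / 945" by (simp add: field_simps)
  with Z show ?thesis by simp
qed

text \<open>Since \<^term>\<open>{d::nat. d dvd 0}\<close> is infinite, the sum gives the value 0 at 0.\<close>

definition sigma5 :: "nat \<Rightarrow> nat" where
  "sigma5 n = (\<Sum>d | d dvd n. d ^ 5)"

lemma sigma5_0 [simp]: "sigma5 0 = 0"
  by (simp add: sigma5_def)

lemma sigma5_le: "sigma5 n \<le> n ^ 6"
proof (cases "n = 0")
  case False
  have "sigma5 n \<le> (\<Sum>d\<in>{1..n}. n ^ 5)"
    unfolding sigma5_def using False
  proof (intro sum_le_included[where i = "\<lambda>x. x"])
    show "\<forall>x\<in>{d. d dvd n}. \<exists>y\<in>{1..n}. y = x \<and> x ^ 5 \<le> n ^ 5"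
      using False by (auto simp: Suc_le_eq dvd_imp_le intro!: power_mono Nat.gr0I)
  qed auto
  then show ?thesis by (simp add: eval_nat_numeral)
qed simp

text \<open>The \<open>j\<close>-fold application of \<open>q d/dq\<close> to \<open>\<Sum> \<sigma>\<^sub>5(n) q\<^sup>n\<close>.\<close>

definition divisor_series :: "nat \<Rightarrow> complex \<Rightarrow> complex" where
  "divisor_series j q = (\<Sum>n. of_nat n ^ j * of_nat (sigma5 n) * q ^ n)"

section \<open>Convergence and differentiation of the divisor series\<close>

lemma summable_times_index:
  fixes c :: "nat \<Rightarrow> 'a :: {real_normed_field, banach}"
  assumes "\<And>q. norm q < 1 \<Longrightarrow> summable (\<lambda>k. c k * q ^ k)" "norm q < 1"
  shows "summable (\<lambda>k. of_nat k * c k * q ^ k)"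
proof -
  have "summable (\<lambda>n. diffs c n * q ^ n)"
    using termdiff_converges[of q 1 c] assms by auto
  then have "summable (\<lambda>n. q * (diffs c n * q ^ n))" by (rule summable_mult)
  then have "summable (\<lambda>n. of_nat (Suc n) * c (Suc n) * q ^ Suc n)"
    by (simp add: diffs_def algebra_simps del: of_nat_Suc)
  then show ?thesis by (subst (asm) summable_Suc_iff)
qed

lemma summable_power_times_index:
  fixes c :: "nat \<Rightarrow> 'a :: {real_normed_field, banach}"
  assumes "\<And>q. norm q < 1 \<Longrightarrow> summable (\<lambda>k. c k * q ^ k)" "norm q < 1"
  shows "summable (\<lambda>k. of_nat k ^ j * c k * q ^ k)"
  using assms(2)
proof (induction j arbitrary: q)
  case 0
  then show ?case using assms(1) by simp
next
  case (Suc j)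
  from summable_times_index[OF Suc.IH Suc.prems] show ?case by (simp add: mult.assoc)
qed

lemma summable_power_geometric:
  fixes q :: "'a :: {real_normed_field, banach}"
  assumes "norm q < 1"
  shows "summable (\<lambda>k. of_nat k ^ j * q ^ k)"
  using summable_power_times_index[of "\<lambda>_. 1" q j] assms summable_geometric by auto

lemma summable_norm_sigma5_power:
  fixes q :: complex
  assumes "norm q < 1"
  shows "summable (\<lambda>n. norm (of_nat (sigma5 n) * q ^ n))"
proof (rule summable_comparison_test)
  show "summable (\<lambda>n. real n ^ 6 * norm q ^ n)"
    using summable_power_geometric[of "norm q" 6] assms by simp
  have "real (sigma5 n) \<le> real n ^ 6" for n
    using sigma5_le[of n] by (metis of_nat_le_iff of_nat_power)
  then show "\<exists>N. \<forall>n\<ge>N. norm (norm (of_nat (sigma5 n) * q ^ n)) \<le> real n ^ 6 * norm q ^ n"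
    by (auto simp: norm_mult norm_power intro!: mult_right_mono)
qed

lemma summable_sigma5_power:
  fixes q :: complex
  shows "norm q < 1 \<Longrightarrow> summable (\<lambda>n. of_nat (sigma5 n) * q ^ n)"
  using summable_norm_sigma5_power by (rule summable_norm_cancel)

lemma divisor_series_sums:
  assumes "norm q < 1"
  shows "(\<lambda>n. of_nat n ^ j * of_nat (sigma5 n) * q ^ n) sums divisor_series j q"
  unfolding divisor_series_def
  using summable_power_times_index[OF summable_sigma5_power assms] by (rule summable_sums)

lemma has_field_derivative_divisor_series:
  assumes "norm q < 1" "q \<noteq> 0"
  shows "(divisor_series j has_field_derivative divisor_series (Suc j) q / q) (at q)"
proof -
  obtain D where D: "(divisor_series j has_field_derivative D) (at q)"
    using termdiffs_strong'[of 1 "\<lambda>n. of_nat n ^ j * of_nat (sigma5 n)" q]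
      sums_summable[OF divisor_series_sums] assms unfolding divisor_series_def[abs_def] by blast
  from power_series_step[OF divisor_series_sums assms(1) D]
  have "(\<lambda>n. of_nat n ^ Suc j * of_nat (sigma5 n) * q ^ n) sums (q * D)"
    by (simp add: mult.assoc)
  with divisor_series_sums[OF assms(1)] have "divisor_series (Suc j) q = q * D"
    by (rule sums_unique2)
  with D assms show ?thesis by simp
qed

text \<open>A Lambert series: grouping the pairs \<open>(m, k)\<close> by their product
  \<open>n = m * k\<close> collects exactly the divisors \<open>k\<close> of
  \<open>n\<close>.\<close>

lemma infsum_divisors:
  fixes q :: complex
  assumes "norm q < 1"
  shows "(\<Sum>\<^sub>\<infinity>m\<in>{1::nat..}. \<Sum>k. of_nat k ^ 5 * (q ^ m) ^ k) = divisor_series 0 q"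
proof -
  define f where "f = (\<lambda>(m::nat, k::nat). of_nat k ^ 5 * q ^ (m * k) :: complex)"
  have sq: "(\<lambda>k. real k ^ j * norm q ^ k) summable_on {1..}" for j
  proof (rule summable_on_subset)
    show "(\<lambda>k. real k ^ j * norm q ^ k) summable_on UNIV"
      using summable_power_geometric[of "norm q" j] assms by (subst summable_on_UNIV_nonneg_real_iff) auto
  qed auto
  have sf: "f summable_on {1..} \<times> {1..}"
  proof -
    have "(\<lambda>(m, k). (real m ^ 0 * norm q ^ m) * (real k ^ 5 * norm q ^ k)) summable_on {1..} \<times> {1..}"
      by (intro summable_on_Times_nonneg sq) auto
    then have g: "(\<lambda>x. (1 / norm q) * (case x of (m, k) \<Rightarrow> (real m ^ 0 * norm q ^ m) * (real k ^ 5 * norm q ^ k)))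
        summable_on {1..} \<times> {1..}" by (rule summable_on_cmult_right)
    have le: "norm (f x) \<le> (1 / norm q) * (case x of (m, k) \<Rightarrow> (real m ^ 0 * norm q ^ m) * (real k ^ 5 * norm q ^ k))"
      if "x \<in> {1..} \<times> {1..}" for x
    proof -
      from that obtain a b where x: "x = (Suc a, Suc b)" by (auto simp: Suc_le_eq gr0_conv_Suc)
      show ?thesis
      proof (cases "q = 0")
        case False
        \<comment> \<open>This is \<open>m * k \<ge> m + k - 1\<close>; the missing 1 is paid for by
          the factor \<open>1 / norm q\<close> in the majorant.\<close>
        have "norm q ^ (Suc a * Suc b) \<le> norm q ^ (Suc a + b)"
          using assms by (intro power_decreasing) auto
        then have "(1 + real b) ^ 5 * norm q ^ (Suc a * Suc b) \<le> (1 + real b) ^ 5 * norm q ^ (Suc a + b)"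
          by (rule mult_left_mono) auto
        moreover have "norm (1 + of_nat b :: complex) = 1 + real b"
          by (metis norm_of_nat of_nat_Suc)
        ultimately show ?thesis using False
          by (simp add: x f_def norm_mult norm_power power_add mult_ac)
      qed (simp add: x f_def)
    qed
    show ?thesis
      by (rule abs_summable_summable, rule Infinite_Sum.abs_summable_on_comparison_test'[OF g le])
  qed
  have "(\<Sum>\<^sub>\<infinity>m\<in>{1::nat..}. \<Sum>k. of_nat k ^ 5 * (q ^ m) ^ k) = (\<Sum>\<^sub>\<infinity>m\<in>{1::nat..}. \<Sum>\<^sub>\<infinity>k\<in>{1..}. f (m, k))"
  proof (rule infsum_cong)
    fix m :: nat assume m: "m \<in> {1..}"
    have "norm (q ^ m) < 1" using assms m by (simp add: norm_power power_less_one_iff)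
    then have s: "(\<lambda>k. of_nat k ^ 5 * (q ^ m) ^ k) sums (\<Sum>k. of_nat k ^ 5 * (q ^ m) ^ k)"
      by (intro summable_sums summable_power_geometric)
    have "(\<lambda>k. f (m, k)) summable_on {1..}"
      using summable_on_SigmaD1[of "\<lambda>m k. f (m, k)" "{1..}" "\<lambda>_. {1..}" m] sf m by simp
    then have "((\<lambda>k. f (m, k)) has_sum (\<Sum>\<^sub>\<infinity>k\<in>{1..}. f (m, k))) {1..}" by simp
    then have "((\<lambda>k. of_nat k ^ 5 * (q ^ m) ^ k) has_sum (\<Sum>\<^sub>\<infinity>k\<in>{1..}. f (m, k))) UNIV"
      by (rule has_sum_cong_neutral[THEN iffD1, rotated 3]) (auto simp: f_def power_mult Suc_le_eq)
    then show "(\<Sum>k. of_nat k ^ 5 * (q ^ m) ^ k) = (\<Sum>\<^sub>\<infinity>k\<in>{1..}. f (m, k))"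
      using s has_sum_imp_sums sums_unique2 by blast
  qed
  also have "\<dots> = infsum f ({1..} \<times> {1..})" by (rule infsum_Sigma_banach[OF sf])
  also have "\<dots> = infsum (\<lambda>(n, d). of_nat d ^ 5 * q ^ n) (Sigma {1..} (\<lambda>n. {d. d dvd n}))"
    by (rule infsum_reindex_bij_witness[where j = "\<lambda>(m, k). (m * k, k)" and i = "\<lambda>(n, d). (n div d, d)"])
       (auto simp: f_def Suc_le_eq intro!: Nat.gr0I)
  also have "\<dots> = (\<Sum>\<^sub>\<infinity>n\<in>{1..}. \<Sum>\<^sub>\<infinity>d\<in>{d. d dvd n}. of_nat d ^ 5 * q ^ n)"
  proof -
    have "(\<lambda>(n, d). of_nat d ^ 5 * q ^ n) summable_on (Sigma {1..} (\<lambda>n. {d. d dvd n}))"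
      using sf
      by (subst (asm) summable_on_reindex_bij_witness[where j = "\<lambda>(m, k). (m * k, k)" and i = "\<lambda>(n, d). (n div d, d)"
           and T = "Sigma {1..} (\<lambda>n. {d. d dvd n})" and h = "(\<lambda>(n, d). of_nat d ^ 5 * q ^ n)"])
       (auto simp: f_def Suc_le_eq intro!: Nat.gr0I)
    from infsum_Sigma_banach[OF this] show ?thesis by simp
  qed
  also have "\<dots> = (\<Sum>\<^sub>\<infinity>n\<in>{1..}. of_nat (sigma5 n) * q ^ n)"
    by (rule infsum_cong) (auto simp: sigma5_def sum_distrib_right)
  \<comment> \<open>The additional index 0 contributes nothing because
    \<open>sigma5 0 = 0\<close>.\<close>
  also have "\<dots> = (\<Sum>\<^sub>\<infinity>n. of_nat (sigma5 n) * q ^ n)"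
    by (rule infsum_cong_neutral) (auto simp: Suc_le_eq)
  also have "\<dots> = divisor_series 0 q"
  proof -
    note summable_norm_sigma5_power[OF assms]
    from norm_summable_imp_has_sum[OF this] divisor_series_sums[OF assms, of 0]
    show ?thesis by (simp add: infsumI)
  qed
  finally show ?thesis .
qed

lemma nome_power: "nome (of_nat m * z) = nome z ^ m"
  by (simp add: nome_def exp_of_nat_mult[symmetric] mult_ac)

text \<open>Summation by rows. The row \<open>m = 0\<close> is \<open>2 zeta(6)\<close>, which the
  normalising factors turn into the constant term 1. Rows \<open>m\<close> and \<open>-m\<close>
  agree as the exponent is even, and a row with \<open>m > 0\<close> is the Lipschitz formula at
  \<open>m * \<tau>\<close>.\<close>

lemma eisenstein_E6_divisor_series:
  assumes "Im \<tau> > 0"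
  shows "eisenstein_E6 \<tau> = 1 - 504 * divisor_series 0 (nome \<tau>)"
proof -
  define P where "P = complex_of_real pi ^ 6"
  define L where "L m = (\<Sum>k. of_nat k ^ 5 * (nome \<tau> ^ m) ^ k)" for m :: nat
  define f where "f = (\<lambda>(m, n). 1 / (of_int m * \<tau> + of_int n) ^ 6 :: complex)"
  \<comment> \<open>The rows of the punctured lattice: only the row \<open>m = 0\<close> lacks a
    point.\<close>
  define B where "B m = (if m = (0::int) then - {0} else UNIV :: int set)" for m
  define h where "h m = (\<Sum>\<^sub>\<infinity>n\<in>B m. f (m, n))" for m
  have S: "Sigma UNIV B = UNIV - {(0, 0)}" by (auto simp: B_def split: if_splits)
  have sf: "f summable_on Sigma UNIV B"
    using lattice_sum_summable[OF assms] unfolding S f_def .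
  have h0: "h 0 = 2 * P / 945"
    using infsumI[OF has_sum_inverse_power6_nonzero_int] by (simp add: h_def f_def B_def P_def)
  have hpos: "h (int m) = - (8 * P / 15) * L m" if "m > 0" for m
  proof -
    have "Im (of_nat m * \<tau>) > 0" using assms that by simp
    from lipschitz_formula_6[OF this] show ?thesis using that
      by (simp add: h_def B_def f_def infsumI L_def nome_power P_def)
  qed
  have hneg: "h (- m) = h m" for m
  proof -
    have "f (- m, n) = f (m, - n)" for n
    proof -
      have "of_int (- m) * \<tau> + of_int n = - (of_int m * \<tau> + of_int (- n))" by simp
      then have "(of_int (- m) * \<tau> + of_int n) ^ 6 = (of_int m * \<tau> + of_int (- n)) ^ 6"
        by (metis even_numeral power_minus_even)
      then show ?thesis by (simp only: f_def prod.case)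
    qed
    then show ?thesis unfolding h_def
      by (intro infsum_reindex_bij_witness[of _ uminus uminus]) (auto simp: B_def)
  qed
  have sh: "h summable_on UNIV"
    unfolding h_def using summable_on_Sigma_banach[of "\<lambda>m n. f (m, n)" UNIV B] sf by simp
  have pos: "infsum h (int ` {1..}) = - (8 * P / 15) * divisor_series 0 (nome \<tau>)"
  proof -
    have "infsum h (int ` {1..}) = (\<Sum>\<^sub>\<infinity>m\<in>{1..}. - (8 * P / 15) * L m)"
      by (subst infsum_reindex) (auto intro!: infsum_cong simp: hpos)
    also have "\<dots> = - (8 * P / 15) * divisor_series 0 (nome \<tau>)"
      using infsum_divisors[OF norm_nome_less_1[OF assms]] unfolding L_def
      by (simp only: infsum_cmult_right')
    finally show ?thesis .
  qed
  have neg: "infsum h (uminus ` int ` {1..}) = infsum h (int ` {1..})"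
    by (subst infsum_reindex) (auto intro!: infsum_cong simp: hneg)
  have U: "UNIV = {0} \<union> (int ` {1..} \<union> uminus ` int ` {1..})"
  proof -
    have "x \<in> {0} \<union> (int ` {1..} \<union> uminus ` int ` {1..})" for x
      by (cases x rule: int_cases3) (auto simp: image_iff Suc_le_eq)
    then show ?thesis by blast
  qed
  have "(\<Sum>\<^sub>\<infinity>x\<in>UNIV - {(0, 0)}. f x) = infsum h UNIV"
    unfolding h_def S[symmetric] by (rule infsum_Sigma_banach[OF sf, symmetric])
  also have "\<dots> = infsum h {0} + (infsum h (int ` {1..}) + infsum h (uminus ` int ` {1..}))"
    using summable_on_subset[OF sh]
    by (subst U, subst infsum_Un_disjoint) (auto intro!: infsum_Un_disjoint)
  also have "\<dots> = 2 * P / 945 - 2 * (8 * P / 15) * divisor_series 0 (nome \<tau>)"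
    unfolding neg pos by (simp add: h0)
  finally have *: "(\<Sum>\<^sub>\<infinity>x\<in>UNIV - {(0, 0)}. f x) = 2 * P / 945 - 2 * (8 * P / 15) * divisor_series 0 (nome \<tau>)" .
  have "P \<noteq> 0" by (simp add: P_def)
  then show ?thesis
    unfolding eisenstein_E6_def eisenstein_g3_def f_def[symmetric] * P_def[symmetric]
    by (simp add: field_simps)
qed

section \<open>Numerical estimates for the divisor series\<close>

lemma sigma5_small: "sigma5 1 = 1" "sigma5 2 = 33" "sigma5 3 = 244"
proof -
  have "{d. d dvd (1::nat)} = {1}" by auto
  then show "sigma5 1 = 1" by (simp add: sigma5_def)
  have "d dvd 2 \<longleftrightarrow> d = 1 \<or> d = 2" for d :: nat
    by (meson two_is_prime_nat prime_nat_iff one_dvd dvd_refl)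
  then have "{d. d dvd (2::nat)} = {1, 2}" by auto
  then show "sigma5 2 = 33" by (simp add: sigma5_def)
  have "d dvd 3 \<longleftrightarrow> d = 1 \<or> d = 3" for d :: nat
  proof
    assume d: "d dvd 3"
    then have "d \<le> 3" by (rule dvd_imp_le) simp
    then have "d = 0 \<or> d = 1 \<or> d = 2 \<or> d = 3" by linarith
    with d show "d = 1 \<or> d = 3" by auto
  qed auto
  then have "{d. d dvd (3::nat)} = {1, 3}" by auto
  then show "sigma5 3 = 244" by (simp add: sigma5_def)
qed

text \<open>Each step in \<open>k\<close> multiplies the left side by at most
  \<open>(5/4) ^ 8 < 6\<close>. The exponent 8 is what
  \<open>n ^ j * sigma5 n \<le> n ^ (j + 6)\<close> requires for \<open>j \<le> 2\<close>; the tail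
  from \<open>n = 4\<close> on is thus majorised by a geometric series of ratio
  \<open>6 * norm q\<close>.\<close>

lemma power_growth_from_4:
  assumes "p \<le> 8"
  shows "(4 + real k) ^ p \<le> 4 ^ p * 6 ^ k"
proof (induction k)
  case (Suc k)
  have "4 + real (Suc k) = (4 + real k) * (1 + 1 / (4 + real k))" by (simp add: field_simps)
  then have "(4 + real (Suc k)) ^ p = (4 + real k) ^ p * (1 + 1 / (4 + real k)) ^ p"
    by (metis power_mult_distrib)
  also have "\<dots> \<le> (4 ^ p * 6 ^ k) * 6"
  proof (intro mult_mono Suc.IH)
    have "(1 + 1 / (4 + real k)) ^ p \<le> (1 + 1 / (4 + real k)) ^ 8" using assms by (intro power_increasing) auto
    also have "\<dots> \<le> (5 / 4) ^ 8" by (intro power_mono) (auto simp: field_simps)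
    also have "\<dots> \<le> 6" by (simp add: eval_nat_numeral)
    finally show "(1 + 1 / (4 + real k)) ^ p \<le> 6" .
  qed auto
  finally show ?case by (simp add: mult_ac)
qed simp

text \<open>33 and 244 are \<open>sigma5 2\<close> and \<open>sigma5 3\<close>. All terms from
  \<open>q ^ 4\<close> on are absorbed into \<open>s\<close>, where they amount to at most
  \<open>4 ^ (j + 6) / 220 / (1 - 6 / 220)\<close>, less than \<open>20 * 4 ^ j\<close>.\<close>

lemma divisor_series_expansion:
  assumes "norm q \<le> 1 / 220" "j \<le> 2"
  obtains s where "divisor_series j q = q + 33 * 2 ^ j * q ^ 2 + s * q ^ 3"
    "norm s \<le> 244 * 3 ^ j + 20 * 4 ^ j"
proof -
  define a where "a n = of_nat n ^ j * of_nat (sigma5 n) * q ^ n" for n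
  define t where "t = (\<Sum>k. of_nat (k + 4) ^ j * of_nat (sigma5 (k + 4)) * q ^ k)"
  have q1: "norm q < 1" using assms by simp
  have "(\<lambda>k. a (k + 4)) sums (divisor_series j q - (\<Sum>i<4. a i))"
    using divisor_series_sums[OF q1, of j] unfolding a_def by (subst sums_iff_shift) simp
  moreover have bound: "norm (of_nat (k + 4) ^ j * of_nat (sigma5 (k + 4)) * q ^ k) \<le> 4 ^ (j + 6) * (6 * norm q) ^ k" for k
  proof -
    have "real (sigma5 (k + 4)) \<le> (4 + real k) ^ 6"
      using sigma5_le[of "k + 4"] by (metis of_nat_le_iff of_nat_power of_nat_add add.commute of_nat_numeral)
    then have "(4 + real k) ^ j * real (sigma5 (k + 4)) \<le> (4 + real k) ^ (j + 6)"
      by (simp add: power_add mult_left_mono)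
    also have "\<dots> \<le> 4 ^ (j + 6) * 6 ^ k" using assms by (intro power_growth_from_4) auto
    finally have "(4 + real k) ^ j * real (sigma5 (k + 4)) * norm q ^ k \<le> 4 ^ (j + 6) * 6 ^ k * norm q ^ k"
      by (rule mult_right_mono) auto
    moreover have "real (k + 4) = 4 + real k" by simp
    ultimately show ?thesis
      by (simp only: norm_mult norm_power norm_of_nat power_mult_distrib mult_ac)
  qed
  have g: "(\<lambda>k. 4 ^ (j + 6) * (6 * norm q) ^ k) sums (4 ^ (j + 6) * (1 / (1 - 6 * norm q)))"
    using assms by (intro sums_mult geometric_sums) auto
  have st: "summable (\<lambda>k. of_nat (k + 4) ^ j * of_nat (sigma5 (k + 4)) * q ^ k)"
    by (rule summable_comparison_test[OF _ sums_summable[OF g]]) (use bound in blast)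
  have "(\<lambda>k. a (k + 4)) sums (q ^ 4 * t)"
    using sums_mult[OF summable_sums[OF st], of "q ^ 4"] unfolding t_def a_def
    by (simp add: power_add mult_ac)
  ultimately have "divisor_series j q = (\<Sum>i<4. a i) + q ^ 4 * t"
    by (metis sums_unique2 diff_add_cancel add.commute)
  also have "(\<Sum>i<4. a i) = q + 33 * 2 ^ j * q ^ 2 + 244 * 3 ^ j * q ^ 3"
    using sigma5_small by (simp add: a_def eval_nat_numeral)
  finally have "divisor_series j q = q + 33 * 2 ^ j * q ^ 2 + (244 * 3 ^ j + q * t) * q ^ 3"
    by (simp add: algebra_simps eval_nat_numeral)
  moreover have "norm t \<le> 4 ^ (j + 6) * (1 / (1 - 6 * norm q))"
  proof -
    have "norm t \<le> (\<Sum>k. 4 ^ (j + 6) * (6 * norm q) ^ k)"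
      unfolding t_def by (rule norm_suminf_le[OF bound sums_summable[OF g]])
    then show ?thesis using g by (simp add: sums_iff)
  qed
  moreover have "norm (244 * 3 ^ j + q * t) \<le> 244 * 3 ^ j + 20 * 4 ^ j" if "norm t \<le> 4 ^ (j + 6) * (1 / (1 - 6 * norm q))"
  proof -
    have "1 / (1 - 6 * norm q) \<le> 1 / (1 - 6 * (1/220))"
      using assms by (intro divide_left_mono) auto
    then have "4 ^ (j + 6) * (1 / (1 - 6 * norm q)) \<le> 4 ^ (j + 6) * (1 / (1 - 6 * (1/220)))"
      by (intro mult_left_mono) auto
    with that have t: "norm t \<le> 4 ^ (j + 6) * (1 / (1 - 6 * (1/220)))" by linarith
    have "norm q * norm t \<le> (1/220) * (4 ^ (j + 6) * (1 / (1 - 6 * (1/220))))"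
      using assms t by (intro mult_mono) auto
    also have "\<dots> \<le> 20 * 4 ^ j" by (simp add: power_add)
    finally have "norm (q * t) \<le> 20 * 4 ^ j" by (simp add: norm_mult)
    moreover have "norm (244 * 3 ^ j :: complex) = 244 * 3 ^ j" by (simp add: norm_mult norm_power)
    ultimately show ?thesis by (smt (verit) norm_triangle_ineq)
  qed
  ultimately show ?thesis using that by blast
qed

lemma cubic_bounds:
  assumes "norm q \<le> 1 / 220"
  obtains s0 s1 s2 where
    "divisor_series 0 q = q + 33 * q ^ 2 + s0 * q ^ 3" "norm s0 \<le> 264"
    "divisor_series 1 q = q + 66 * q ^ 2 + s1 * q ^ 3" "norm s1 \<le> 812"
    "divisor_series 2 q = q + 132 * q ^ 2 + s2 * q ^ 3" "norm s2 \<le> 2516"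
proof -
  obtain s0 where "divisor_series 0 q = q + 33 * 2 ^ 0 * q ^ 2 + s0 * q ^ 3" "norm s0 \<le> 244 * 3 ^ 0 + 20 * 4 ^ 0"
    using divisor_series_expansion[OF assms, of 0] by auto
  moreover obtain s1 where "divisor_series 1 q = q + 33 * 2 ^ 1 * q ^ 2 + s1 * q ^ 3" "norm s1 \<le> 244 * 3 ^ 1 + 20 * 4 ^ 1"
    using divisor_series_expansion[OF assms, of 1] by auto
  moreover obtain s2 where "divisor_series 2 q = q + 33 * 2 ^ 2 * q ^ 2 + s2 * q ^ 3" "norm s2 \<le> 244 * 3 ^ 2 + 20 * 4 ^ 2"
    using divisor_series_expansion[OF assms, of 2] by auto
  ultimately show ?thesis by (intro that[of s0 s1 s2]) auto
qed

section \<open>Explicit asymptotics of h and its derivative for small q\<close>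

lemma norm_mult_le:
  fixes x y :: complex
  shows "norm x \<le> a \<Longrightarrow> norm y \<le> b \<Longrightarrow> norm (x * y) \<le> a * b"
  by (simp add: norm_mult mult_mono')

text \<open>The factor left after dividing \<open>divisor_series 1 q\<close> by \<open>q\<close>.
  This series is the denominator in \<open>h\<close> and in its derivative, so it has to be kept
  away from 0.\<close>

lemma norm_leading_factor_ge:
  fixes q s :: complex
  assumes "norm q \<le> r" "norm s \<le> 812"
  shows "norm (1 + 66 * q + s * q ^ 2) \<ge> 1 - 66 * r - 812 * r ^ 2"
proof -
  have "norm (q ^ 2) \<le> r ^ 2" using assms by (simp add: norm_power power_mono)
  then have "norm (s * q ^ 2) \<le> 812 * r ^ 2" using assms by (intro norm_mult_le)
  moreover have "norm (66 * q) \<le> 66 * r" using assms by (simp add: norm_mult)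
  ultimately have "norm (66 * q + s * q ^ 2) \<le> 66 * r + 812 * r ^ 2"
    by (intro norm_triangle_mono)
  then show ?thesis using norm_diff_ineq[of 1 "66 * q + s * q ^ 2"]
    by (simp add: add.assoc)
qed

lemma divisor_series_1_nonzero:
  assumes "norm q \<le> 1 / 220" "q \<noteq> 0"
  shows "divisor_series 1 q \<noteq> 0"
proof -
  obtain s0 s1 s2 where s: "divisor_series 1 q = q + 66 * q ^ 2 + s1 * q ^ 3" "norm s1 \<le> 812"
    using cubic_bounds[OF assms(1)] by metis
  have "divisor_series 1 q = q * (1 + 66 * q + s1 * q ^ 2)"
    unfolding s by (simp add: algebra_simps eval_nat_numeral)
  moreover have "norm (1 + 66 * q + s1 * q ^ 2) \<ge> 1 - 66 * (1 / 220) - 812 * (1 / 220) ^ 2"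
    by (rule norm_leading_factor_ge[OF assms(1) s(2)])
  then have "1 + 66 * q + s1 * q ^ 2 \<noteq> 0"
    by (auto simp: power2_eq_square simp del: zero_less_norm_iff)
  ultimately show ?thesis using assms by simp
qed

text \<open>The constant 570 is 504 + 66, from
  \<open>(1 - 504 q) / (1 + 66 q) = 1 - 570 q + ...\<close>. The factor 36000 is a bound of about
  24509 for the numerator \<open>N\<close>, divided by 0.683 and rounded up.\<close>

lemma quotient_estimate:
  assumes "norm q \<le> 1 / 220" "q \<noteq> 0"
  shows "norm ((1 - 504 * divisor_series 0 q) / divisor_series 1 q - (1 / q - 570)) \<le> 36000 * norm q"
proof -
  obtain s0 s1 s2 where s: "divisor_series 0 q = q + 33 * q ^ 2 + s0 * q ^ 3" "norm s0 \<le> 264"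
    "divisor_series 1 q = q + 66 * q ^ 2 + s1 * q ^ 3" "norm s1 \<le> 812"
    using cubic_bounds[OF assms(1)] by metis
  define A where "A = 1 + 66 * q + s1 * q ^ 2"
  \<comment> \<open>By the choice of 570 the numerator of the difference vanishes to third order;
    \<open>N\<close> is its cofactor.\<close>
  define N where "N = 20988 - s1 + q * (570 * s1 - 504 * s0)"
  have A: "norm A \<ge> 0.683"
    using norm_leading_factor_ge[OF assms(1) s(4)] by (simp add: A_def power2_eq_square)
  then have A0: "A \<noteq> 0" by auto
  have d1: "divisor_series 1 q = q * A" unfolding s A_def by (simp add: algebra_simps eval_nat_numeral)
  have "(1 - 504 * divisor_series 0 q) / divisor_series 1 q - (1 / q - 570) =
      ((1 - 504 * divisor_series 0 q) * q - (1 - 570 * q) * (q * A)) / (q * (q * A))"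
    using assms A0 unfolding d1 by (simp add: field_simps)
  also have "(1 - 504 * divisor_series 0 q) * q - (1 - 570 * q) * (q * A) = q ^ 3 * N"
    unfolding s A_def N_def by (simp add: algebra_simps eval_nat_numeral)
  also have "q ^ 3 * N / (q * (q * A)) = q * (N / A)"
    using assms A0 by (simp add: eval_nat_numeral)
  finally have e: "(1 - 504 * divisor_series 0 q) / divisor_series 1 q - (1 / q - 570) = q * (N / A)" .
  have "norm (20988 - s1) \<le> 20988 + 812" using s norm_triangle_ineq4[of 20988 s1] by simp
  moreover have "norm (q * (570 * s1 - 504 * s0)) \<le> (1/220) * (570 * 812 + 504 * 264)"
    using s assms by (intro norm_mult_le order_trans[OF norm_triangle_ineq4] add_mono) (auto simp: norm_mult)
  ultimately have "norm N \<le> 20988 + 812 + (1/220) * (570 * 812 + 504 * 264)"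
    unfolding N_def by (rule norm_triangle_mono)
  then have "norm N \<le> 36000 * 0.683" by simp
  also have "\<dots> \<le> 36000 * norm A" using A by simp
  finally have "norm (N / A) \<le> 36000" using A0 by (simp add: norm_divide divide_le_eq)
  then have "norm q * norm (N / A) \<le> norm q * 36000" by (rule mult_left_mono) simp
  then show ?thesis unfolding e by (simp only: norm_mult mult.commute)
qed

text \<open>The quantity is \<open>h' - 1 - 1 / (84 q)\<close>: the 7 in \<open>h'\<close> is split
  as 1 + 6, and the 6 cancels the constant term \<open>-504 / 84\<close> of the quotient. The
  sharper threshold 1/350 suffices because the derivative is needed only on the box where
  \<open>h\<close> is shown to be injective.\<close>

lemma derivative_estimate:
  assumes "norm q \<le> 1 / 350" "q \<noteq> 0"
  shows "norm (6 + (1 - 504 * divisor_series 0 q) * divisor_series 2 q / (84 * divisor_series 1 q ^ 2) - 1 / (84 * q))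
    \<le> 620 * norm q"
proof -
  have q: "norm q \<le> 1 / 220" using assms by simp
  obtain s0 s1 s2 where s: "divisor_series 0 q = q + 33 * q ^ 2 + s0 * q ^ 3" "norm s0 \<le> 264"
    "divisor_series 1 q = q + 66 * q ^ 2 + s1 * q ^ 3" "norm s1 \<le> 812"
    "divisor_series 2 q = q + 132 * q ^ 2 + s2 * q ^ 3" "norm s2 \<le> 2516"
    using cubic_bounds[OF q] by metis
  define A where "A = 1 + 66 * q + s1 * q ^ 2"
  define B where "B = 1 + 132 * q + s2 * q ^ 2"
  \<comment> \<open>\<open>c2\<close> to \<open>c5\<close> are the coefficients of
    \<open>q ^ 2\<close> to \<open>q ^ 5\<close> in the numerator below. Its lower coefficients
    vanish since \<open>A ^ 2\<close> and \<open>B\<close> both begin with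
    \<open>1 + 132 q\<close>.\<close>
  define c2 where "c2 = s2 - 2 * s1 - 20988"
  define c3 where "c3 = 1008 * s1 - 504 * s2 - 504 * s0 - 132 * s1"
  define c4 where "c4 = 66528 * s1 - 16632 * s2 - 66528 * s0 - s1 * s1"
  define c5 where "c5 = 504 * (s1 * s1) - 504 * (s0 * s2)"
  define N where "N = c2 + c3 * q + c4 * q ^ 2 + c5 * q ^ 3"
  have A: "norm A \<ge> 0.804"
    using norm_leading_factor_ge[OF assms(1) s(4)] by (simp add: A_def power2_eq_square)
  then have A0: "A \<noteq> 0" by auto
  have d1: "divisor_series 1 q = q * A" unfolding s A_def by (simp add: algebra_simps eval_nat_numeral)
  have d2: "divisor_series 2 q = q * B" unfolding s B_def by (simp add: algebra_simps eval_nat_numeral)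
  have "6 + (1 - 504 * divisor_series 0 q) * divisor_series 2 q / (84 * divisor_series 1 q ^ 2) - 1 / (84 * q)
     = ((1 - 504 * divisor_series 0 q) * B - (1 - 504 * q) * A ^ 2) / (84 * q * A ^ 2)"
    using assms A0 unfolding d1 d2 by (simp add: field_simps power2_eq_square)
  also have "(1 - 504 * divisor_series 0 q) * B - (1 - 504 * q) * A ^ 2 = q ^ 2 * N"
    unfolding s A_def B_def N_def c2_def c3_def c4_def c5_def by (simp add: algebra_simps eval_nat_numeral)
  also have "q ^ 2 * N / (84 * q * A ^ 2) = q * (N / (84 * A ^ 2))"
    using assms A0 by (simp add: eval_nat_numeral)
  finally have e: "6 + (1 - 504 * divisor_series 0 q) * divisor_series 2 q / (84 * divisor_series 1 q ^ 2) - 1 / (84 * q)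
     = q * (N / (84 * A ^ 2))" .
  have k: "norm (numeral k * x) \<le> numeral k * b" if "norm x \<le> b" for k and x :: complex and b
    using that by (simp add: norm_mult)
  have t4: "norm (x - y) \<le> a + b" if "norm x \<le> a" "norm y \<le> b" for x y :: complex and a b
    using that norm_triangle_ineq4[of x y] by linarith
  have c2: "norm c2 \<le> 2516 + 2 * 812 + 20988"
    unfolding c2_def by (intro t4 k s) auto
  have c3: "norm c3 \<le> 1008 * 812 + 504 * 2516 + 504 * 264 + 132 * 812"
    unfolding c3_def by (intro t4 k s)
  have c4: "norm c4 \<le> 66528 * 812 + 16632 * 2516 + 66528 * 264 + 812 * 812"
    unfolding c4_def by (intro t4 k s norm_mult_le)
  have c5: "norm c5 \<le> 504 * (812 * 812) + 504 * (264 * 2516)"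
    unfolding c5_def by (intro t4 k s norm_mult_le)
  have qp: "norm (q ^ n) \<le> (1/350) ^ n" for n
    unfolding norm_power by (rule power_mono[OF assms(1)]) simp
  have "norm N \<le> (2516 + 2 * 812 + 20988) + (1008 * 812 + 504 * 2516 + 504 * 264 + 132 * 812) * (1/350)
     + (66528 * 812 + 16632 * 2516 + 66528 * 264 + 812 * 812) * (1/350) ^ 2
     + (504 * (812 * 812) + 504 * (264 * 2516)) * (1/350) ^ 3"
    unfolding N_def by (intro norm_triangle_mono norm_mult_le c2 c3 c4 c5 qp assms)
  then have "norm N \<le> 620 * (84 * 0.804 ^ 2)" by (simp add: eval_nat_numeral)
  also have "\<dots> \<le> 620 * (84 * norm A ^ 2)"
    using A by (intro mult_left_mono power_mono) auto
  finally have "norm (N / (84 * A ^ 2)) \<le> 620"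
    using A0 by (simp add: norm_divide divide_le_eq norm_mult norm_power)
  then have "norm q * norm (N / (84 * A ^ 2)) \<le> norm q * 620" by (rule mult_left_mono) simp
  then show ?thesis unfolding e by (simp only: norm_mult mult.commute)
qed

section \<open>Modularity and the equivariant function\<close>

lemma nome_nonzero [simp]: "nome \<tau> \<noteq> 0"
  by (simp add: nome_def)

lemma has_field_derivative_nome:
  "(nome has_field_derivative 2 * of_real pi * \<i> * nome \<tau>) (at \<tau>)"
  unfolding nome_def[abs_def] by (auto intro!: derivative_eq_intros)

lemma has_field_derivative_divisor_series_nome:
  assumes "Im \<tau> > 0"
  shows "((\<lambda>\<tau>. divisor_series j (nome \<tau>)) has_field_derivative
    2 * of_real pi * \<i> * divisor_series (Suc j) (nome \<tau>)) (at \<tau>)"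
  using DERIV_chain2[OF has_field_derivative_divisor_series[OF norm_nome_less_1[OF assms]] has_field_derivative_nome]
  by (simp add: mult_ac)

lemma has_field_derivative_eisenstein_E6:
  assumes "Im \<tau> > 0"
  shows "(eisenstein_E6 has_field_derivative - 1008 * of_real pi * \<i> * divisor_series 1 (nome \<tau>)) (at \<tau>)"
proof (rule has_field_derivative_transform_within_open[where S = "{z. Im z > 0}"])
  show "((\<lambda>z. 1 - 504 * divisor_series 0 (nome z)) has_field_derivative
      - 1008 * of_real pi * \<i> * divisor_series 1 (nome \<tau>)) (at \<tau>)"
    using assms by (auto intro!: derivative_eq_intros has_field_derivative_divisor_series_nome)
qed (use assms in \<open>auto simp: open_halfspace_Im_gt eisenstein_E6_divisor_series\<close>)

section \<open>The transformation law of E6 and of its derivative\<close>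

lemma modular_denominator_nonzero:
  fixes a b c d :: int
  assumes "a * d - b * c = 1" "Im \<tau> > 0"
  shows "of_int c * \<tau> + of_int d \<noteq> 0"
proof
  assume 0: "of_int c * \<tau> + of_int d = 0"
  have "Im (of_int c * \<tau> + of_int d) = of_int c * Im \<tau>" by simp
  then have "of_int c * Im \<tau> = 0" using 0 by simp
  then have "c = 0" using assms by simp
  with 0 have "d = 0" by simp
  with \<open>c = 0\<close> assms show False by simp
qed

lemma Im_modular_act:
  fixes a b c d :: int
  assumes "a * d - b * c = 1" "Im \<tau> > 0"
  shows "Im (modular_act a b c d \<tau>) > 0"
proof -
  have r: "real_of_int a * of_int d - of_int b * of_int c = 1"
    using assms(1) by (metis of_int_1 of_int_diff of_int_mult)
  have nz: "of_int c * \<tau> + of_int d \<noteq> 0" by (rule modular_denominator_nonzero[OF assms])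
  have "Im (modular_act a b c d \<tau>) =
     (of_int a * of_int d - of_int b * of_int c) * Im \<tau> / (norm (of_int c * \<tau> + of_int d))\<^sup>2"
    unfolding modular_act_def moebius_def Im_divide cmod_power2 by (simp add: algebra_simps)
  also have "\<dots> = Im \<tau> / (norm (of_int c * \<tau> + of_int d))\<^sup>2" using r by simp
  also have "\<dots> > 0" using nz assms by simp
  finally show ?thesis .
qed

text \<open>Right multiplication of the row vector \<open>(m, n)\<close> by the matrix permutes the
  nonzero lattice points, the determinant being 1. Each term of the sum picks up the same factor
  \<open>D ^ 6\<close>.\<close>

lemma eisenstein_E6_modular:
  fixes a b c d :: int
  assumes "a * d - b * c = 1" "Im \<tau> > 0"
  shows "eisenstein_E6 (modular_act a b c d \<tau>) = (of_int c * \<tau> + of_int d) ^ 6 * eisenstein_E6 \<tau>"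
proof -
  define D where "D = of_int c * \<tau> + of_int d"
  have D: "D \<noteq> 0" unfolding D_def by (rule modular_denominator_nonzero[OF assms])
  have inv1: "d * (m * a + n * c) - c * (m * b + n * d) = m" "a * (m * b + n * d) - b * (m * a + n * c) = n"
    and inv2: "(d * m - c * n) * a + (a * n - b * m) * c = m" "(d * m - c * n) * b + (a * n - b * m) * d = n" for m n
  proof -
    have e: "d * (m * a + n * c) - c * (m * b + n * d) = m * (a * d - b * c)"
      "a * (m * b + n * d) - b * (m * a + n * c) = n * (a * d - b * c)"
      "(d * m - c * n) * a + (a * n - b * m) * c = m * (a * d - b * c)"
      "(d * m - c * n) * b + (a * n - b * m) * d = n * (a * d - b * c)"
      by (simp_all add: algebra_simps)
    show "d * (m * a + n * c) - c * (m * b + n * d) = m" "a * (m * b + n * d) - b * (m * a + n * c) = n"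
      "(d * m - c * n) * a + (a * n - b * m) * c = m" "(d * m - c * n) * b + (a * n - b * m) * d = n"
      unfolding e assms(1) by simp_all
  qed
  have "(\<Sum>\<^sub>\<infinity>(m, n)\<in>(UNIV :: (int \<times> int) set) - {(0, 0)}. 1 / (of_int m * modular_act a b c d \<tau> + of_int n) ^ 6)
     = (\<Sum>\<^sub>\<infinity>(m, n)\<in>(UNIV :: (int \<times> int) set) - {(0, 0)}. D ^ 6 * (1 / (of_int m * \<tau> + of_int n) ^ 6))"
  proof (rule infsum_reindex_bij_witness[where j = "\<lambda>(m, n). (m * a + n * c, m * b + n * d)"
        and i = "\<lambda>(m, n). (d * m - c * n, a * n - b * m)"])
    fix x :: "int \<times> int" assume x: "x \<in> UNIV - {(0, 0)}"
    obtain m n where mn: "x = (m, n)" by fastforce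
    show "(case case x of (m, n) \<Rightarrow> (m * a + n * c, m * b + n * d) of (m, n) \<Rightarrow> (d * m - c * n, a * n - b * m)) = x"
      by (simp add: mn inv1)
    show "(case case x of (m, n) \<Rightarrow> (d * m - c * n, a * n - b * m) of (m, n) \<Rightarrow> (m * a + n * c, m * b + n * d)) = x"
      by (simp add: mn inv2)
    show "(case x of (m, n) \<Rightarrow> (m * a + n * c, m * b + n * d)) \<in> UNIV - {(0, 0)}"
      using x inv1[of m n] by (auto simp: mn)
    show "(case x of (m, n) \<Rightarrow> (d * m - c * n, a * n - b * m)) \<in> UNIV - {(0, 0)}"
      using x inv2[of m n] by (auto simp: mn)
    have "of_int m * modular_act a b c d \<tau> + of_int n = (of_int (m * a + n * c) * \<tau> + of_int (m * b + n * d)) / D"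
      using D unfolding modular_act_def moebius_def D_def by (simp add: field_simps)
    then show "(case case x of (m, n) \<Rightarrow> (m * a + n * c, m * b + n * d) of (m, n) \<Rightarrow> D ^ 6 * (1 / (of_int m * \<tau> + of_int n) ^ 6)) =
      (case x of (m, n) \<Rightarrow> 1 / (of_int m * modular_act a b c d \<tau> + of_int n) ^ 6)"
      by (simp add: mn power_divide)
  qed
  also have "\<dots> = D ^ 6 * (\<Sum>\<^sub>\<infinity>(m, n)\<in>(UNIV :: (int \<times> int) set) - {(0, 0)}. 1 / (of_int m * \<tau> + of_int n) ^ 6)"
    unfolding case_prod_unfold by (rule infsum_cmult_right')
  finally show ?thesis
    unfolding eisenstein_E6_def eisenstein_g3_def D_def[symmetric] by simp
qed

lemma has_field_derivative_modular_act:
  fixes a b c d :: int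
  assumes "a * d - b * c = 1" "Im \<tau> > 0"
  shows "(modular_act a b c d has_field_derivative 1 / (of_int c * \<tau> + of_int d) ^ 2) (at \<tau>)"
proof -
  have r: "complex_of_int a * of_int d - of_int b * of_int c = 1"
    using assms(1) by (metis of_int_1 of_int_diff of_int_mult)
  have nz: "of_int c * \<tau> + of_int d \<noteq> 0" by (rule modular_denominator_nonzero[OF assms])
  have "(modular_act a b c d has_field_derivative
     (of_int a * (of_int c * \<tau> + of_int d) - (of_int a * \<tau> + of_int b) * of_int c) /
       ((of_int c * \<tau> + of_int d) * (of_int c * \<tau> + of_int d))) (at \<tau>)"
    unfolding modular_act_def moebius_def using nz by (auto intro!: derivative_eq_intros)
  also have "of_int a * (of_int c * \<tau> + of_int d) - (of_int a * \<tau> + of_int b) * of_int c = 1"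
    using r by (simp add: algebra_simps)
  finally show ?thesis by (simp add: power2_eq_square)
qed

lemma deriv_eisenstein_E6_modular:
  fixes a b c d :: int
  assumes "a * d - b * c = 1" "Im \<tau> > 0"
  defines "D \<equiv> of_int c * \<tau> + of_int d"
  shows "deriv eisenstein_E6 (modular_act a b c d \<tau>) =
     D ^ 7 * (D * deriv eisenstein_E6 \<tau> + 6 * of_int c * eisenstein_E6 \<tau>)"
proof -
  have D: "D \<noteq> 0" unfolding D_def by (rule modular_denominator_nonzero[OF assms(1,2)])
  have E: "(eisenstein_E6 has_field_derivative deriv eisenstein_E6 z) (at z)" if "Im z > 0" for z
    using has_field_derivative_eisenstein_E6[OF that] DERIV_deriv_iff_has_field_derivative by blast
  have "deriv eisenstein_E6 (modular_act a b c d \<tau>) * (1 / D ^ 2) =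
     6 * D ^ 5 * of_int c * eisenstein_E6 \<tau> + D ^ 6 * deriv eisenstein_E6 \<tau>"
  proof (rule DERIV_eq_on_open[of "{z. Im z > 0}" \<tau>])
    show "((\<lambda>z. eisenstein_E6 (modular_act a b c d z)) has_field_derivative
       deriv eisenstein_E6 (modular_act a b c d \<tau>) * (1 / D ^ 2)) (at \<tau>)"
      unfolding D_def
      by (rule DERIV_chain2[OF E[OF Im_modular_act] has_field_derivative_modular_act]) (use assms in auto)
    show "((\<lambda>z. (of_int c * z + of_int d) ^ 6 * eisenstein_E6 z) has_field_derivative
       6 * D ^ 5 * of_int c * eisenstein_E6 \<tau> + D ^ 6 * deriv eisenstein_E6 \<tau>) (at \<tau>)"
      by (rule derivative_eq_intros E assms refl | simp add: D_def)+
  qed (use assms in \<open>auto simp: open_halfspace_Im_gt eisenstein_E6_modular\<close>)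
  then have "deriv eisenstein_E6 (modular_act a b c d \<tau>) =
     (6 * D ^ 5 * of_int c * eisenstein_E6 \<tau> + D ^ 6 * deriv eisenstein_E6 \<tau>) * D ^ 2"
    using D by (simp add: field_simps)
  then show ?thesis by (simp add: algebra_simps eval_nat_numeral)
qed

text \<open>This is \<open>\<tau> + 6 E\<^sub>6 / E\<^sub>6'\<close>, which commutes with the action of the modular group.\<close>

definition E6_equivariant :: "complex \<Rightarrow> complex" where
  "E6_equivariant \<tau> = \<tau> + \<i> / (168 * of_real pi) *
     ((1 - 504 * divisor_series 0 (nome \<tau>)) / divisor_series 1 (nome \<tau>))"

lemma Im_pos_of_norm_nome: "norm (nome \<tau>) < 1 \<Longrightarrow> Im \<tau> > 0"
  by (simp add: norm_nome zero_less_mult_iff)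

lemma E6_equivariant_eq:
  assumes "norm (nome \<tau>) \<le> 1 / 220"
  shows "deriv eisenstein_E6 \<tau> \<noteq> 0"
    and "\<tau> * deriv eisenstein_E6 \<tau> + 6 * eisenstein_E6 \<tau> = deriv eisenstein_E6 \<tau> * E6_equivariant \<tau>"
proof -
  have im: "Im \<tau> > 0" using assms by (intro Im_pos_of_norm_nome) linarith
  have nz: "divisor_series 1 (nome \<tau>) \<noteq> 0" by (rule divisor_series_1_nonzero[OF assms]) simp
  have d: "deriv eisenstein_E6 \<tau> = - 1008 * of_real pi * \<i> * divisor_series 1 (nome \<tau>)"
    by (rule DERIV_imp_deriv[OF has_field_derivative_eisenstein_E6[OF im]])
  show "deriv eisenstein_E6 \<tau> \<noteq> 0" using nz by (simp add: d)
  show "\<tau> * deriv eisenstein_E6 \<tau> + 6 * eisenstein_E6 \<tau> = deriv eisenstein_E6 \<tau> * E6_equivariant \<tau>"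
    unfolding d eisenstein_E6_divisor_series[OF im] E6_equivariant_def
    using nz by (simp add: field_simps)
qed

lemma E6_critical_point_modular_act_iff:
  fixes a b c d :: int
  assumes "a * d - b * c = 1" "norm (nome \<tau>) \<le> 1 / 220"
  shows "E6_critical_point (modular_act a b c d \<tau>) \<longleftrightarrow> of_int c * E6_equivariant \<tau> + of_int d = 0"
proof -
  have im: "Im \<tau> > 0" using assms by (intro Im_pos_of_norm_nome) linarith
  note e = E6_equivariant_eq[OF assms(2)]
  have nz: "of_int c * \<tau> + of_int d \<noteq> 0" by (rule modular_denominator_nonzero[OF assms(1) im])
  have "(of_int c * \<tau> + of_int d) * deriv eisenstein_E6 \<tau> + 6 * of_int c * eisenstein_E6 \<tau> =
     of_int c * (\<tau> * deriv eisenstein_E6 \<tau> + 6 * eisenstein_E6 \<tau>) + of_int d * deriv eisenstein_E6 \<tau>"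
    by (simp add: algebra_simps)
  also have "\<dots> = deriv eisenstein_E6 \<tau> * (of_int c * E6_equivariant \<tau> + of_int d)"
    unfolding e(2) by (simp add: algebra_simps)
  finally show ?thesis
    using e(1) nz Im_modular_act[OF assms(1) im]
    by (simp add: E6_critical_point_def upper_half_plane_def deriv_eisenstein_E6_modular[OF assms(1) im])
qed

section \<open>Behaviour of h under reflections, and its derivative\<close>

lemma nome_minus_cnj: "nome (- cnj \<tau>) = cnj (nome \<tau>)"
  by (simp add: nome_def exp_cnj)

lemma nome_plus_1: "nome (1 + \<tau>) = nome \<tau>"
  by (simp add: nome_def distrib_left exp_add exp_eq_1)

lemma divisor_series_cnj:
  assumes "norm q < 1"
  shows "divisor_series j (cnj q) = cnj (divisor_series j q)"
proof -
  have "(\<lambda>n. cnj (of_nat n ^ j * of_nat (sigma5 n) * q ^ n)) sums cnj (divisor_series j q)"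
    using divisor_series_sums[OF assms] by (simp only: sums_cnj)
  moreover have "(\<lambda>n. of_nat n ^ j * of_nat (sigma5 n) * cnj q ^ n) sums divisor_series j (cnj q)"
    using assms by (intro divisor_series_sums) simp
  ultimately show ?thesis by (simp add: sums_unique2)
qed

lemma E6_equivariant_reflect:
  assumes "Im \<tau> > 0"
  shows "E6_equivariant (1 - cnj \<tau>) = 1 - cnj (E6_equivariant \<tau>)"
  using nome_plus_1[of "- cnj \<tau>"] norm_nome_less_1[OF assms]
  by (simp add: E6_equivariant_def nome_minus_cnj divisor_series_cnj)

text \<open>On the circle \<open>-1/\<tau> = - cnj \<tau>\<close>. The transformation law under
  \<open>-1/\<tau>\<close> reads \<open>E6'(-1/\<tau>) = \<tau>^7 E6'(\<tau>) h(\<tau>)\<close>,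
  while real q-coefficients give \<open>E6'\<close> the same modulus at \<open>\<tau>\<close> and
  \<open>- cnj \<tau>\<close>. The common factor is nonzero and cancels.\<close>

lemma norm_E6_equivariant_unit_circle:
  assumes "norm (nome \<tau>) \<le> 1 / 220" "norm \<tau> = 1"
  shows "norm (E6_equivariant \<tau>) = 1"
proof -
  have im: "Im \<tau> > 0" using assms by (intro Im_pos_of_norm_nome) linarith
  note e = E6_equivariant_eq[OF assms(1)]
  have d: "deriv eisenstein_E6 z = - 1008 * of_real pi * \<i> * divisor_series 1 (nome z)" if "Im z > 0" for z
    by (rule DERIV_imp_deriv[OF has_field_derivative_eisenstein_E6[OF that]])
  have "\<tau> * cnj \<tau> = 1" using assms(2) by (simp add: complex_norm_square[symmetric])
  moreover have "\<tau> \<noteq> 0" using im by auto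
  ultimately have "1 / \<tau> = cnj \<tau>" by (simp add: divide_eq_eq mult.commute)
  then have "modular_act 0 (-1) 1 0 \<tau> = - cnj \<tau>"
    by (simp add: modular_act_def moebius_def)
  then have "deriv eisenstein_E6 (- cnj \<tau>) = \<tau> ^ 7 * (deriv eisenstein_E6 \<tau> * E6_equivariant \<tau>)"
    using deriv_eisenstein_E6_modular[of 0 0 "-1" 1 \<tau>] im e(2) by simp
  then have "norm (deriv eisenstein_E6 (- cnj \<tau>)) = norm (deriv eisenstein_E6 \<tau>) * norm (E6_equivariant \<tau>)"
    by (simp add: norm_mult norm_power assms)
  moreover have "norm (deriv eisenstein_E6 (- cnj \<tau>)) = norm (deriv eisenstein_E6 \<tau>)"
    using im norm_nome_less_1[OF im] by (simp add: d nome_minus_cnj divisor_series_cnj norm_mult)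
  ultimately show ?thesis using e(1) by simp
qed

lemma has_field_derivative_E6_equivariant:
  assumes "norm (nome \<tau>) \<le> 1 / 220"
  defines "q \<equiv> nome \<tau>"
  shows "(E6_equivariant has_field_derivative
    7 + (1 - 504 * divisor_series 0 q) * divisor_series 2 q / (84 * divisor_series 1 q ^ 2)) (at \<tau>)"
proof -
  have im: "Im \<tau> > 0" using assms by (intro Im_pos_of_norm_nome) linarith
  have nz: "divisor_series 1 (nome \<tau>) \<noteq> 0" by (rule divisor_series_1_nonzero[OF assms(1)]) simp
  note D = has_field_derivative_divisor_series_nome[OF im]
  have D1: "((\<lambda>\<tau>. divisor_series 1 (nome \<tau>)) has_field_derivative
    2 * of_real pi * \<i> * divisor_series 2 (nome \<tau>)) (at \<tau>)"
    using D[of 1] by (simp add: numeral_2_eq_2)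
  have D0: "((\<lambda>\<tau>. divisor_series 0 (nome \<tau>)) has_field_derivative
    2 * of_real pi * \<i> * divisor_series 1 (nome \<tau>)) (at \<tau>)"
    using D[of 0] by simp
  have "(E6_equivariant has_field_derivative
    1 + \<i> / (168 * of_real pi) * ((- (504 * (2 * of_real pi * \<i> * divisor_series 1 q)) * divisor_series 1 q -
      (1 - 504 * divisor_series 0 q) * (2 * of_real pi * \<i> * divisor_series 2 q)) / (divisor_series 1 q * divisor_series 1 q))) (at \<tau>)"
    unfolding E6_equivariant_def[abs_def] q_def
    by (rule derivative_eq_intros D0 D1 refl nz | simp add: mult_ac)+
  also have "1 + \<i> / (168 * of_real pi) * ((- (504 * (2 * of_real pi * \<i> * divisor_series 1 q)) * divisor_series 1 q -
      (1 - 504 * divisor_series 0 q) * (2 * of_real pi * \<i> * divisor_series 2 q)) / (divisor_series 1 q * divisor_series 1 q))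
    = 7 + (1 - 504 * divisor_series 0 q) * divisor_series 2 q / (84 * divisor_series 1 q ^ 2)"
    using nz unfolding q_def[symmetric] by (simp add: field_simps power2_eq_square)
  finally show ?thesis .
qed

lemma inverse_nome:
  "Re (1 / nome \<tau>) = exp (2 * pi * Im \<tau>) * cos (2 * pi * Re \<tau>)"
  "Im (1 / nome \<tau>) = - exp (2 * pi * Im \<tau>) * sin (2 * pi * Re \<tau>)"
proof -
  have "1 / nome \<tau> = exp (- (2 * of_real pi * \<i> * \<tau>))" by (simp add: nome_def exp_minus inverse_eq_divide)
  then show "Re (1 / nome \<tau>) = exp (2 * pi * Im \<tau>) * cos (2 * pi * Re \<tau>)"
    "Im (1 / nome \<tau>) = - exp (2 * pi * Im \<tau>) * sin (2 * pi * Re \<tau>)"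
    by (simp_all add: Re_exp Im_exp)
qed

lemma norm_nome_le_iff:
  assumes "c > 0"
  shows "norm (nome \<tau>) \<le> 1 / c \<longleftrightarrow> c \<le> exp (2 * pi * Im \<tau>)"
  using assms by (simp add: norm_nome exp_minus field_simps)

text \<open>\<open>1 / q\<close> has modulus \<open>Q\<close> and argument
  \<open>-2 pi Re \<tau>\<close>. The factor \<open>\<i>\<close> in \<open>h\<close> interchanges
  real and imaginary parts, so the sine governs \<open>Re h\<close>, and the cosine together with
  -570 governs \<open>Im h\<close>.\<close>

lemma E6_equivariant_estimate:
  assumes "exp (2 * pi * Im \<tau>) \<ge> 220"
  defines "Q \<equiv> exp (2 * pi * Im \<tau>)"
  shows "\<bar>168 * pi * (Re (E6_equivariant \<tau>) - Re \<tau>) - Q * sin (2 * pi * Re \<tau>)\<bar> \<le> 36000 / Q"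
    and "\<bar>168 * pi * (Im (E6_equivariant \<tau>) - Im \<tau>) - (Q * cos (2 * pi * Re \<tau>) - 570)\<bar> \<le> 36000 / Q"
proof -
  have n: "norm (nome \<tau>) \<le> 1 / 220" using assms norm_nome_le_iff[of 220 \<tau>] by simp
  define E where "E = (1 - 504 * divisor_series 0 (nome \<tau>)) / divisor_series 1 (nome \<tau>) - (1 / nome \<tau> - 570)"
  have "norm E \<le> 36000 * norm (nome \<tau>)" unfolding E_def by (rule quotient_estimate[OF n]) simp
  then have E: "norm E \<le> 36000 / Q" by (simp add: norm_nome Q_def exp_minus field_simps)
  have "E6_equivariant \<tau> = \<tau> + \<i> / (168 * of_real pi) * ((1 / nome \<tau> - 570) + E)"
    by (simp add: E6_equivariant_def E_def)
  then have "168 * of_real pi * (E6_equivariant \<tau> - \<tau>) = \<i> * ((1 / nome \<tau> - 570) + E)"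
    by simp
  then have "of_real (168 * pi) * (E6_equivariant \<tau> - \<tau>) = \<i> * ((1 / nome \<tau> - 570) + E)"
    by simp
  moreover have "Re (of_real r * z) = r * Re z" "Im (of_real r * z) = r * Im z" for r z by simp_all
  ultimately have "168 * pi * Re (E6_equivariant \<tau> - \<tau>) = Re (\<i> * ((1 / nome \<tau> - 570) + E))"
    "168 * pi * Im (E6_equivariant \<tau> - \<tau>) = Im (\<i> * ((1 / nome \<tau> - 570) + E))"
    by metis+
  then have "168 * pi * (Re (E6_equivariant \<tau>) - Re \<tau>) = Q * sin (2 * pi * Re \<tau>) - Im E"
    "168 * pi * (Im (E6_equivariant \<tau>) - Im \<tau>) = Q * cos (2 * pi * Re \<tau>) - 570 + Re E"
    unfolding Re_i_times Im_i_times minus_complex.sel plus_complex.sel inverse_nome Q_def by simp_all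
  moreover have "\<bar>Re E\<bar> \<le> 36000 / Q" "\<bar>Im E\<bar> \<le> 36000 / Q"
    using E abs_Re_le_cmod[of E] abs_Im_le_cmod[of E] by linarith+
  ultimately show "\<bar>168 * pi * (Re (E6_equivariant \<tau>) - Re \<tau>) - Q * sin (2 * pi * Re \<tau>)\<bar> \<le> 36000 / Q"
    "\<bar>168 * pi * (Im (E6_equivariant \<tau>) - Im \<tau>) - (Q * cos (2 * pi * Re \<tau>) - 570)\<bar> \<le> 36000 / Q"
    by linarith+
qed

section \<open>Real values on the left half of the fundamental domain\<close>

lemma pi_decimal: "(314159/100000) \<le> pi" "pi \<le> (3927/1250)"
  using pi_approx by auto

lemma exp_1_decimal: "(1359/500) \<le> exp (1::real)"
proof -
  have "5837465777 / 2147483648 - exp 1 \<le> inverse (2 ^ 32 :: real)" using e_approx_32 by linarith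
  then show ?thesis by simp
qed

lemma exp_lower_bounds:
  "exp (2 * pi * (433/500)) \<ge> 220" "exp (2 * pi * (47/50)) \<ge> 350" "exp (2 * pi * (493/500)) \<ge> 400"
proof -
  have e: "exp (real n) \<ge> (1359/500) ^ n" for n
    using power_mono[OF exp_1_decimal, of n] exp_of_nat_mult[of n "1::real"] by simp
  have "(220::real) \<le> (1359/500) ^ 5 * (1 + 0.44 + 0.44\<^sup>2 / 2)" by (simp add: eval_nat_numeral)
  also have "\<dots> \<le> exp (real 5) * exp 0.44"
    by (intro mult_mono e exp_lower_Taylor_quadratic) auto
  also have "\<dots> = exp (5.44)" by (simp add: exp_add[symmetric])
  also have "\<dots> \<le> exp (2 * pi * (433/500))" using pi_decimal by simp
  finally show "exp (2 * pi * (433/500)) \<ge> 220" .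
  \<comment> \<open>The exponent 0.9 is halved: a single quadratic Taylor bound for
    \<open>exp 0.9\<close> would yield only about 342.\<close>
  have "(350::real) \<le> (1359/500) ^ 5 * ((1 + 0.45 + 0.45\<^sup>2 / 2) * (1 + 0.45 + 0.45\<^sup>2 / 2))"
    by (simp add: eval_nat_numeral)
  also have "\<dots> \<le> exp (real 5) * (exp 0.45 * exp 0.45)"
    by (intro mult_mono e exp_lower_Taylor_quadratic) auto
  also have "\<dots> = exp (5.9)" by (simp add: exp_add[symmetric])
  also have "\<dots> \<le> exp (2 * pi * (47/50))" using pi_decimal by simp
  finally show "exp (2 * pi * (47/50)) \<ge> 350" .
  have "(400::real) \<le> (1359/500) ^ 6" by (simp add: eval_nat_numeral)
  also have "\<dots> \<le> exp (real 6)" by (rule e)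
  also have "\<dots> \<le> exp (2 * pi * (493/500))" using pi_decimal by simp
  finally show "exp (2 * pi * (493/500)) \<ge> 400" .
qed

lemma exp_2pi_mono: "a \<le> b \<Longrightarrow> exp (2 * pi * a) \<le> exp (2 * pi * b)"
  by simp

text \<open>Tangent line of the exponential at the lowest height of the region, with slope
  \<open>2 pi\<close> rounded down to 6. It is needed where \<open>Q\<close> has to beat a term
  linear in \<open>Im \<tau>\<close>.\<close>

lemma exp_2pi_affine_lower:
  assumes "y \<ge> (433/500)"
  shows "exp (2 * pi * y) \<ge> 220 * (1 + 6 * (y - (433/500)))"
proof -
  have "220 * (1 + 6 * (y - (433/500))) \<le> 220 * (1 + 2 * pi * (y - (433/500)))"
    using assms pi_decimal by (intro mult_left_mono add_left_mono mult_right_mono) auto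
  also have "\<dots> \<le> exp (2 * pi * (433/500)) * exp (2 * pi * (y - (433/500)))"
    using assms by (intro mult_mono exp_lower_bounds exp_ge_add_one_self) auto
  also have "\<dots> = exp (2 * pi * y)" by (simp add: exp_add[symmetric] algebra_simps)
  finally show ?thesis .
qed

section \<open>Localising the points with real values\<close>

definition left_half :: "complex set" where
  "left_half = {\<tau>. Im \<tau> > 0 \<and> 0 \<le> Re \<tau> \<and> Re \<tau> \<le> 1 / 2 \<and> norm \<tau> \<ge> 1}"

text \<open>Applied with \<open>x\<close> equal to 1/2, 1/3 and 1/6, and with \<open>y\<close> equal
  to 433/500, 47/50 and 493/500, rational numbers just below \<open>sqrt (1 - x^2)\<close>.\<close>

lemma Im_ge_outside_unit_circle:
  assumes "norm \<tau> \<ge> 1" "Im \<tau> > 0" "\<bar>Re \<tau>\<bar> \<le> x" "x\<^sup>2 + y\<^sup>2 \<le> 1"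
  shows "Im \<tau> \<ge> y"
proof -
  have "1 \<le> (norm \<tau>)\<^sup>2" using assms(1) by simp
  also have "\<dots> = (Re \<tau>)\<^sup>2 + (Im \<tau>)\<^sup>2" by (rule cmod_power2)
  also have "(Re \<tau>)\<^sup>2 \<le> x\<^sup>2" using power_mono[OF assms(3) abs_ge_zero, of 2] by simp
  finally have "y\<^sup>2 \<le> (Im \<tau>)\<^sup>2" using assms by simp
  then show ?thesis using assms(2) power2_le_imp_le[of y "Im \<tau>"] by simp
qed

lemma left_half_Im_ge:
  assumes "\<tau> \<in> left_half"
  shows "Im \<tau> \<ge> (433/500)"
  by (rule Im_ge_outside_unit_circle[where x = "1/2"]) (use assms in \<open>auto simp: left_half_def power2_eq_square\<close>)

lemma exp_ge_220:
  assumes "Im \<tau> \<ge> (433/500)"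
  shows "exp (2 * pi * Im \<tau>) \<ge> 220"
  using exp_lower_bounds(1) exp_2pi_mono[OF assms] by linarith

lemma divide_36000_le: "c \<le> Q \<Longrightarrow> c > 0 \<Longrightarrow> 36000 / Q \<le> 36000 / (c::real)"
  by (rule divide_left_mono) auto

text \<open>After multiplication by \<open>168 pi\<close> the contributions are at least 520 from
  \<open>Im \<tau>\<close>, 200 from the cosine term, -570 from the constant and -90 from the
  remainder.\<close>

lemma Im_E6_equivariant_pos:
  assumes "\<tau> \<in> left_half" "Re \<tau> \<le> 1 / 6"
  shows "Im (E6_equivariant \<tau>) > 0"
proof -
  define Q where "Q = exp (2 * pi * Im \<tau>)"
  have y: "Im \<tau> \<ge> (493/500)"
    by (rule Im_ge_outside_unit_circle[where x = "1/6"]) (use assms in \<open>auto simp: left_half_def power2_eq_square\<close>)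
  have Q: "Q \<ge> 400" using exp_lower_bounds(3) exp_2pi_mono[OF y] unfolding Q_def by linarith
  have "cos (2 * pi * Re \<tau>) \<ge> cos (pi / 3)"
    using assms pi_gt_zero by (intro cos_monotone_0_pi_le) (auto simp: left_half_def field_simps)
  then have c: "cos (2 * pi * Re \<tau>) \<ge> 1 / 2" by (simp add: cos_60)
  have "Q * cos (2 * pi * Re \<tau>) \<ge> 400 * (1 / 2)" using Q c by (intro mult_mono) auto
  moreover have "36000 / Q \<le> 90" using divide_36000_le[OF Q] by simp
  moreover have "\<bar>168 * pi * (Im (E6_equivariant \<tau>) - Im \<tau>) - (Q * cos (2 * pi * Re \<tau>) - 570)\<bar> \<le> 36000 / Q"
    unfolding Q_def by (rule E6_equivariant_estimate) (use Q in \<open>simp add: Q_def\<close>)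
  moreover have "168 * pi * Im \<tau> \<ge> 168 * (314159/100000) * (493/500)" using y pi_decimal by (intro mult_mono) auto
  ultimately have "168 * pi * Im (E6_equivariant \<tau>) > 0"
    unfolding right_diff_distrib by linarith
  then show ?thesis using pi_gt_zero by (simp add: zero_less_mult_iff)
qed

text \<open>The cosine term is at most \<open>-Q / 2\<close>, but it competes with
  \<open>168 pi * Im \<tau>\<close>, which is unbounded. The affine minorant of \<open>Q\<close> has
  slope 1320, so \<open>-Q / 2\<close> is bounded above by a line of slope -660, against slope at
  most 528 from the other term.\<close>

lemma Im_E6_equivariant_neg:
  assumes "\<tau> \<in> left_half" "Re \<tau> \<ge> 1 / 3"
  shows "Im (E6_equivariant \<tau>) < 0"
proof -
  define Q where "Q = exp (2 * pi * Im \<tau>)"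
  have y: "Im \<tau> \<ge> (433/500)" by (rule left_half_Im_ge[OF assms(1)])
  have Q: "Q \<ge> 220" unfolding Q_def by (rule exp_ge_220[OF y])
  have Q': "Q \<ge> 220 * (1 + 6 * (Im \<tau> - (433/500)))" unfolding Q_def by (rule exp_2pi_affine_lower[OF y])
  have "cos (2 * pi * Re \<tau>) \<le> cos (2 * pi / 3)"
    using assms pi_gt_zero by (intro cos_monotone_0_pi_le) (auto simp: left_half_def field_simps)
  also have "cos (2 * pi / 3) = - (1 / 2)"
    using cos_pi_minus[of "pi / 3"] by (simp add: cos_60)
  finally have "Q * cos (2 * pi * Re \<tau>) \<le> - (Q / 2)" using Q mult_left_mono[of _ "- (1/2)" Q] by fastforce
  moreover have "36000 / Q \<le> 164" using divide_36000_le[OF Q] by simp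
  moreover have "\<bar>168 * pi * (Im (E6_equivariant \<tau>) - Im \<tau>) - (Q * cos (2 * pi * Re \<tau>) - 570)\<bar> \<le> 36000 / Q"
    unfolding Q_def by (rule E6_equivariant_estimate) (use Q in \<open>simp add: Q_def\<close>)
  moreover have "168 * pi * Im \<tau> \<le> 528 * Im \<tau>" using y pi_decimal by (intro mult_right_mono) auto
  moreover have "Q \<ge> 1320 * Im \<tau> - 924" using Q' by simp
  ultimately have "168 * pi * Im (E6_equivariant \<tau>) < 0"
    using y unfolding right_diff_distrib by linarith
  then show ?thesis using pi_gt_zero by (simp add: mult_less_0_iff)
qed

text \<open>A rectangle, and not the part of \<open>left_half\<close> over the same interval,
  because the mean value argument below needs convexity. It reaches slightly inside the unit circle;
  47/50 lies just below the arc at \<open>Re \<tau> = 1/3\<close>.\<close>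

definition injectivity_box :: "complex set" where
  "injectivity_box = {\<tau>. 1 / 6 \<le> Re \<tau> \<and> Re \<tau> \<le> 1 / 3 \<and> (47/50) \<le> Im \<tau>}"

lemma convex_injectivity_box: "convex injectivity_box"
proof -
  have eq: "injectivity_box = {\<tau>. 1 / 6 \<le> Re \<tau>} \<inter> {\<tau>. Re \<tau> \<le> 1 / 3} \<inter> {\<tau>. (47/50) \<le> Im \<tau>}"
    by (auto simp: injectivity_box_def)
  show ?thesis unfolding eq
    by (intro convex_Int convex_halfspace_Re_ge convex_halfspace_Re_le convex_halfspace_Im_ge)
qed

lemma box_bounds:
  assumes "\<tau> \<in> injectivity_box"
  shows "exp (2 * pi * Im \<tau>) \<ge> 350" "sin (2 * pi * Re \<tau>) \<ge> (433/500)"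
proof -
  show "exp (2 * pi * Im \<tau>) \<ge> 350"
    by (rule order_trans[OF exp_lower_bounds(2) exp_2pi_mono]) (use assms in \<open>auto simp: injectivity_box_def\<close>)
  have "cos (pi / 6) \<le> cos \<bar>pi / 2 - 2 * pi * Re \<tau>\<bar>"
  proof (rule cos_monotone_0_pi_le)
    have "pi * (1 / 6) \<le> pi * Re \<tau>" "pi * Re \<tau> \<le> pi * (1 / 3)"
      using assms by (auto simp: injectivity_box_def intro!: mult_left_mono)
    then show "\<bar>pi / 2 - 2 * pi * Re \<tau>\<bar> \<le> pi / 6" by linarith
  qed auto
  also have "\<dots> = sin (2 * pi * Re \<tau>)" by (simp add: cos_diff)
  finally have "sqrt 3 / 2 \<le> sin (2 * pi * Re \<tau>)" by (simp add: cos_30)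
  moreover have "sqrt 3 \<ge> (433/250)" by (rule real_le_rsqrt) (simp add: power2_eq_square)
  ultimately show "sin (2 * pi * Re \<tau>) \<ge> (433/500)" by linarith
qed

lemma Re_E6_equivariant_box:
  assumes "\<tau> \<in> injectivity_box"
  shows "168 * pi * Re (E6_equivariant \<tau>) \<ge> (433/500) * exp (2 * pi * Im \<tau>) - 103"
proof -
  define Q where "Q = exp (2 * pi * Im \<tau>)"
  have Q: "Q \<ge> 350" and s: "sin (2 * pi * Re \<tau>) \<ge> (433/500)"
    using box_bounds[OF assms] by (auto simp: Q_def)
  have "Q * (433/500) \<le> Q * sin (2 * pi * Re \<tau>)" using Q s by (intro mult_left_mono) auto
  moreover have "36000 / Q \<le> 103" using divide_36000_le[OF Q] by simp
  moreover have "\<bar>168 * pi * (Re (E6_equivariant \<tau>) - Re \<tau>) - Q * sin (2 * pi * Re \<tau>)\<bar> \<le> 36000 / Q"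
    unfolding Q_def by (rule E6_equivariant_estimate) (use Q in \<open>simp add: Q_def\<close>)
  moreover have "168 * pi * Re \<tau> \<ge> 0" using assms by (auto simp: injectivity_box_def)
  ultimately show ?thesis unfolding right_diff_distrib Q_def[symmetric] by linarith
qed

text \<open>A holomorphic function on a convex set is injective if its derivative stays in an open
  half-plane, here \<open>Im h' < 0\<close>. If two values agreed, the mean value theorem for the
  real part of \<open>\<i> h / (z - w)\<close> on the segment would give a point with
  \<open>Im h' = 0\<close>.\<close>

lemma inj_on_E6_equivariant_box: "inj_on E6_equivariant injectivity_box"
proof (rule inj_onI, rule ccontr)
  fix w z assume w: "w \<in> injectivity_box" and z: "z \<in> injectivity_box" and eq: "E6_equivariant w = E6_equivariant z" and ne: "w \<noteq> z"
  define f' where "f' u = 7 + (1 - 504 * divisor_series 0 (nome u)) * divisor_series 2 (nome u) /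
    (84 * divisor_series 1 (nome u) ^ 2)" for u
  have seg: "u \<in> injectivity_box" if "u \<in> closed_segment w z" for u
    using closed_segment_subset[OF w z convex_injectivity_box] that by blast
  have "\<exists>u. u \<in> closed_segment w z \<and>
     Re (\<i> / (z - w) * E6_equivariant z) - Re (\<i> / (z - w) * E6_equivariant w) = Re (\<i> / (z - w) * f' u * (z - w))"
  proof (rule complex_mvt_line)
    fix u assume "u \<in> closed_segment w z"
    then have "norm (nome u) \<le> 1 / 220"
      using box_bounds(1)[OF seg[of u]] norm_nome_le_iff[of 220 u] by simp
    then show "((\<lambda>z'. \<i> / (z - w) * E6_equivariant z') has_field_derivative \<i> / (z - w) * f' u) (at u)"
      unfolding f'_def by (intro DERIV_cmult has_field_derivative_E6_equivariant)
  qed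
  then obtain u where u: "u \<in> injectivity_box" "Re (\<i> / (z - w) * f' u * (z - w)) = 0"
    using seg eq by auto
  moreover have "\<i> / (z - w) * f' u * (z - w) = \<i> * f' u" using ne by simp
  ultimately have 0: "Im (f' u) = 0" by simp
  define Q where "Q = exp (2 * pi * Im u)"
  have Q: "Q \<ge> 350" and s: "sin (2 * pi * Re u) \<ge> (433/500)"
    using box_bounds[OF u(1)] by (auto simp: Q_def)
  have "norm (nome u) \<le> 1 / 350" using Q norm_nome_le_iff[of 350 u] by (simp add: Q_def)
  then have "norm (f' u - 1 - 1 / (84 * nome u)) \<le> 620 * (1 / 350)"
    using derivative_estimate[of "nome u"] by (simp add: f'_def)
  then have "\<bar>Im (f' u - 1 - 1 / (84 * nome u))\<bar> \<le> 620 * (1 / 350)"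
    using abs_Im_le_cmod order_trans by blast
  moreover have "Im (1 / (84 * nome u)) = - Q * sin (2 * pi * Re u) / 84"
  proof -
    have "1 / (84 * nome u) = (1 / nome u) / of_real 84" by simp
    then show ?thesis by (simp only: Im_divide_of_real inverse_nome Q_def)
  qed
  \<comment> \<open>The main term of \<open>Im h'\<close> is therefore below -3.6, the remainder
    below 1.8 in absolute value.\<close>
  moreover have "350 * (433/500) \<le> Q * sin (2 * pi * Re u)" using Q s by (intro mult_mono) auto
  ultimately show False using 0 by simp
qed

text \<open>In particular no real value occurs on the two vertical sides of
  \<open>left_half\<close>, so the arc is the only part of its boundary that matters later.\<close>

lemma left_half_real_value:
  assumes "\<tau> \<in> left_half" "Im (E6_equivariant \<tau>) = 0"
  shows "\<tau> \<in> injectivity_box" "1 / 6 < Re \<tau>" "Re \<tau> < 1 / 3" "Re (E6_equivariant \<tau>) > 0"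
proof -
  show x: "1 / 6 < Re \<tau>" "Re \<tau> < 1 / 3"
    using Im_E6_equivariant_pos[OF assms(1)] Im_E6_equivariant_neg[OF assms(1)] assms(2) by force+
  have "Im \<tau> \<ge> (47/50)"
    by (rule Im_ge_outside_unit_circle[where x = "1/3"]) (use assms x in \<open>auto simp: left_half_def power2_eq_square\<close>)
  with x show b: "\<tau> \<in> injectivity_box" by (simp add: injectivity_box_def)
  have "168 * pi * Re (E6_equivariant \<tau>) > 0"
    using Re_E6_equivariant_box[OF b] box_bounds(1)[OF b] by linarith
  then show "Re (E6_equivariant \<tau>) > 0" using pi_gt_zero by (simp add: zero_less_mult_iff)
qed

lemma continuous_on_E6_equivariant: "continuous_on {\<tau>. Im \<tau> \<ge> (433/500)} E6_equivariant"
proof (rule continuous_at_imp_continuous_on, clarify)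
  fix \<tau> :: complex assume "Im \<tau> \<ge> (433/500)"
  then have "norm (nome \<tau>) \<le> 1 / 220" using exp_ge_220 norm_nome_le_iff[of 220 \<tau>] by simp
  then show "isCont E6_equivariant \<tau>" using DERIV_isCont has_field_derivative_E6_equivariant by blast
qed

section \<open>The set of real values on the left half\<close>

definition real_values :: "real set" where
  "real_values = {r. \<exists>\<tau>\<in>left_half. E6_equivariant \<tau> = of_real r}"

text \<open>An open set containing every point of \<open>left_half\<close> with real value except
  those on the arc; openness makes the open mapping theorem applicable.\<close>

definition open_region :: "complex set" where
  "open_region = {\<tau>. 1 / 6 < Re \<tau> \<and> Re \<tau> < 1 / 3 \<and> 0 < Im \<tau> \<and> 1 < norm \<tau>}"

lemma open_region_subset: "open_region \<subseteq> left_half" "open_region \<subseteq> injectivity_box"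
proof -
  show "open_region \<subseteq> left_half" by (auto simp: open_region_def left_half_def)
  have "Im \<tau> \<ge> (47/50)" if "\<tau> \<in> open_region" for \<tau>
    by (rule Im_ge_outside_unit_circle[where x = "1/3"]) (use that in \<open>auto simp: open_region_def power2_eq_square\<close>)
  then show "open_region \<subseteq> injectivity_box" by (auto simp: open_region_def injectivity_box_def)
qed

lemma open_open_region: "open open_region"
proof -
  have eq: "open_region = {\<tau>. 1 / 6 < Re \<tau>} \<inter> {\<tau>. Re \<tau> < 1 / 3} \<inter> {\<tau>. 0 < Im \<tau>} \<inter> {\<tau>. 1 < norm \<tau>}"
    by (auto simp: open_region_def)
  show ?thesis unfolding eq
    by (intro open_Int open_halfspace_Re_gt open_halfspace_Re_lt open_halfspace_Im_gt
        open_Collect_less continuous_intros)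
qed

lemma open_E6_equivariant_image: "open (E6_equivariant ` open_region)"
proof (rule open_mapping_thm3)
  show "E6_equivariant holomorphic_on open_region"
  proof (rule holomorphic_onI)
    fix \<tau> assume "\<tau> \<in> open_region"
    then have "norm (nome \<tau>) \<le> 1 / 220"
      using open_region_subset box_bounds(1)[of \<tau>] norm_nome_le_iff[of 220 \<tau>] by auto
    from has_field_derivative_E6_equivariant[OF this]
    show "E6_equivariant field_differentiable at \<tau> within open_region"
      using field_differentiable_at_within field_differentiable_def by blast
  qed
  show "inj_on E6_equivariant open_region"
    using inj_on_E6_equivariant_box open_region_subset(2) by (rule inj_on_subset)
qed (rule open_open_region)

definition interior_values :: "real set" where
  "interior_values = {r. of_real r \<in> E6_equivariant ` open_region}"

lemma open_interior_values: "open interior_values"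
proof -
  have "interior_values = (of_real :: real \<Rightarrow> complex) -` (E6_equivariant ` open_region)"
    by (auto simp: interior_values_def)
  also have "open \<dots>"
    by (rule open_vimage[OF open_E6_equivariant_image]) (intro continuous_intros)
  finally show ?thesis .
qed

lemma interior_values_subset: "interior_values \<subseteq> real_values"
proof
  fix r assume "r \<in> interior_values"
  then have "of_real r \<in> E6_equivariant ` open_region" by (simp add: interior_values_def)
  then obtain \<tau> where t: "of_real r = E6_equivariant \<tau>" "\<tau> \<in> open_region" by (rule imageE)
  have "\<tau> \<in> left_half" using open_region_subset(1) t(2) by (rule subsetD)
  with t(1) have "\<exists>\<tau>\<in>left_half. E6_equivariant \<tau> = of_real r" by (intro bexI[of _ \<tau>]) simp_all
  then show "r \<in> real_values" by (simp add: real_values_def)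
qed

lemma left_half_unit_circle_value:
  assumes "\<tau> \<in> left_half" "E6_equivariant \<tau> = of_real r" "norm \<tau> = 1"
  shows "r = 1"
proof -
  have "norm (nome \<tau>) \<le> 1 / 220"
    using exp_ge_220[OF left_half_Im_ge[OF assms(1)]] norm_nome_le_iff[of 220 \<tau>] by simp
  from norm_E6_equivariant_unit_circle[OF this assms(3)] have "\<bar>r\<bar> = 1" using assms(2) by simp
  moreover have "r > 0" using left_half_real_value(4)[OF assms(1)] assms(2) by simp
  ultimately show ?thesis by simp
qed

lemma left_half_outside_unit_circle:
  assumes "\<tau> \<in> left_half" "E6_equivariant \<tau> = of_real r" "norm \<tau> \<noteq> 1"
  shows "\<tau> \<in> open_region"
proof -
  have "1 / 6 < Re \<tau>" "Re \<tau> < 1 / 3"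
    using left_half_real_value[OF assms(1)] assms(2) by simp_all
  then show ?thesis using assms by (simp add: open_region_def left_half_def)
qed

lemma real_values_subset: "real_values \<subseteq> insert 1 interior_values"
proof
  fix r assume "r \<in> real_values"
  then obtain \<tau> where t: "\<tau> \<in> left_half" "E6_equivariant \<tau> = of_real r" by (auto simp: real_values_def)
  show "r \<in> insert 1 interior_values"
  proof (cases "norm \<tau> = 1")
    case True then show ?thesis using left_half_unit_circle_value[OF t] by simp
  next
    case False
    have "of_real r \<in> E6_equivariant ` open_region"
      by (rule image_eqI[where f = E6_equivariant, OF t(2)[symmetric] left_half_outside_unit_circle[OF t False]])
    then show ?thesis by (simp add: interior_values_def)
  qed
qed

text \<open>Since \<open>left_half\<close> is unbounded, compactness has to come from a bound on the
  value: \<open>Re h\<close> grows exponentially with \<open>Im \<tau>\<close> on the box, so values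
  up to \<open>R\<close> come from a compact truncation.\<close>

lemma closed_real_values: "closed real_values"
proof -
  have cl: "closed (real_values \<inter> {..R})" for R
  proof -
    \<comment> \<open>Obtained by solving \<open>(433/500) * exp (2 * pi * Im \<tau>) - 103 \<le>
      168 * pi * \<bar>R\<bar>\<close> for the exponential, which in turn exceeds
      \<open>Im \<tau>\<close>.\<close>
    define Y where "Y = (168 * pi * \<bar>R\<bar> + 103) / (433/500)"
    define C where "C = {\<tau> \<in> left_half. Im \<tau> \<le> Y}"
    have eq: "C = {\<tau>. Im \<tau> \<ge> (433/500)} \<inter> {\<tau>. Im \<tau> \<le> Y} \<inter> {\<tau>. Re \<tau> \<ge> 0} \<inter> {\<tau>. Re \<tau> \<le> 1/2} \<inter> {\<tau>. 1 \<le> norm \<tau>}"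
    proof
      show "C \<subseteq> {\<tau>. Im \<tau> \<ge> (433/500)} \<inter> {\<tau>. Im \<tau> \<le> Y} \<inter> {\<tau>. Re \<tau> \<ge> 0} \<inter> {\<tau>. Re \<tau> \<le> 1/2} \<inter> {\<tau>. 1 \<le> norm \<tau>}"
        using left_half_Im_ge unfolding C_def by (auto simp: left_half_def)
    qed (auto simp: C_def left_half_def)
    have "closed C" unfolding eq
      by (intro closed_Int closed_halfspace_Im_ge closed_halfspace_Im_le closed_halfspace_Re_ge
          closed_halfspace_Re_le closed_Collect_le continuous_intros)
    moreover have "bounded C"
    proof (rule boundedI)
      fix \<tau> assume "\<tau> \<in> C"
      then show "norm \<tau> \<le> 1 / 2 + Y"
        using cmod_le[of \<tau>] by (auto simp: C_def left_half_def)
    qed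
    ultimately have "compact C" by (simp add: compact_eq_bounded_closed)
    moreover have "continuous_on C E6_equivariant"
      by (rule continuous_on_subset[OF continuous_on_E6_equivariant]) (use left_half_Im_ge in \<open>auto simp: C_def\<close>)
    ultimately have "closed (E6_equivariant ` C)" by (intro compact_imp_closed compact_continuous_image)
    then have "closed ((of_real :: real \<Rightarrow> complex) -` (E6_equivariant ` C))"
      by (rule closed_vimage) (intro continuous_intros)
    moreover have "real_values \<inter> {..R} = of_real -` (E6_equivariant ` C) \<inter> {..R}"
    proof -
      have "\<tau> \<in> C" if "\<tau> \<in> left_half" "E6_equivariant \<tau> = of_real r" "r \<le> R" for \<tau> r
      proof -
        have b: "\<tau> \<in> injectivity_box" "r > 0" using left_half_real_value[OF that(1)] that(2) by auto
        have "(433/500) * exp (2 * pi * Im \<tau>) - 103 \<le> 168 * pi * r"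
          using Re_E6_equivariant_box[OF b(1)] that(2) by simp
        also have "\<dots> \<le> 168 * pi * \<bar>R\<bar>" using that(3) b(2) by (intro mult_left_mono) auto
        finally have "exp (2 * pi * Im \<tau>) \<le> Y" by (simp add: Y_def field_simps)
        moreover have "Im \<tau> \<le> exp (2 * pi * Im \<tau>)"
        proof -
          have "Im \<tau> * 1 \<le> Im \<tau> * (2 * pi)" using that(1) pi_ge_two by (intro mult_left_mono) (auto simp: left_half_def)
          then have "Im \<tau> \<le> 2 * pi * Im \<tau>" by (simp add: mult_ac)
          moreover have "1 + 2 * pi * Im \<tau> \<le> exp (2 * pi * Im \<tau>)" by (rule exp_ge_add_one_self)
          ultimately show ?thesis by linarith
        qed
        ultimately show ?thesis using that(1) by (simp add: C_def)
      qed
      then have "r \<in> real_values \<longleftrightarrow> of_real r \<in> E6_equivariant ` C" if "r \<le> R" for r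
        using that unfolding real_values_def C_def by (force simp: image_iff)
      then show ?thesis by auto
    qed
    ultimately show ?thesis by (simp add: closed_Int)
  qed
  have "open (- real_values)"
  proof (subst open_subopen, clarify)
    fix r assume r: "r \<notin> real_values"
    \<comment> \<open>Closedness is local: near \<open>r\<close> only the values up to
      \<open>r + 1\<close> matter.\<close>
    have "open (- (real_values \<inter> {..r + 1}) \<inter> {..<r + 1})" using cl by (intro open_Int) (auto simp: closed_def)
    then show "\<exists>T. open T \<and> r \<in> T \<and> T \<subseteq> - real_values"
      using r by (intro exI[of _ "- (real_values \<inter> {..r + 1}) \<inter> {..<r + 1}"]) auto
  qed
  then show ?thesis by (simp add: closed_def)
qed

text \<open>On the line \<open>Im \<tau> = 2\<close> the sign change of \<open>Im h\<close> between
  \<open>Re \<tau> = 1/6\<close> and \<open>1/3\<close> yields a real value, and at that height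
  \<open>Q\<close> is large enough to force \<open>Re h > 1\<close>.\<close>

lemma large_real_value: "\<exists>r\<in>real_values. r > 1"
proof -
  define g where "g x = Im (E6_equivariant (Complex x 2))" for x
  have lh: "Complex x 2 \<in> left_half" if "1/6 \<le> x" "x \<le> 1/3" for x
    using that abs_Im_le_cmod[of "Complex x 2"] by (auto simp: left_half_def)
  have "continuous_on {1/6..1/3} g"
    unfolding g_def Complex_eq
    by (intro continuous_intros continuous_on_compose2[OF continuous_on_E6_equivariant]) auto
  moreover have "g (1/6) > 0" "g (1/3) < 0"
    unfolding g_def by (intro Im_E6_equivariant_pos Im_E6_equivariant_neg lh; simp)+
  ultimately obtain x where x: "1/6 \<le> x" "x \<le> 1/3" "g x = 0"
    using IVT2'[of g "1/3" 0 "1/6"] by auto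
  let ?t = "Complex x 2"
  have b: "?t \<in> injectivity_box" by (rule left_half_real_value[OF lh]) (use x in \<open>auto simp: g_def\<close>)
  have "exp (2 * pi * Im ?t) \<ge> 1700" using exp_2pi_affine_lower[of 2] by simp
  then have "168 * pi * Re (E6_equivariant ?t) > 168 * pi * 1"
    using Re_E6_equivariant_box[OF b] pi_decimal by linarith
  then have "Re (E6_equivariant ?t) > 1" using pi_gt_zero by (subst (asm) mult_less_cancel_left_pos) auto
  moreover have "E6_equivariant ?t = of_real (Re (E6_equivariant ?t))"
    using x by (simp add: g_def complex_eq_iff)
  ultimately show ?thesis using lh[OF x(1,2)] by (auto simp: real_values_def)
qed

text \<open>\<open>interior_values\<close> and the complement of \<open>real_values\<close> are
  disjoint open sets covering all reals but 1. Each of the two rays at 1 is connected and so lies in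
  one of them; one known point per ray decides in which.\<close>

lemma real_values_eq: "real_values = {1..}" "1 \<notin> interior_values"
proof -
  have sep: "interior_values \<inter> S = {} \<or> - real_values \<inter> S = {}" if "connected S" "1 \<notin> S" for S
    by (rule connectedD[OF that(1) open_interior_values])
       (use closed_real_values interior_values_subset real_values_subset that(2) in auto)
  have "0 \<notin> real_values" using left_half_real_value(4) by (fastforce simp: real_values_def)
  then have low: "interior_values \<inter> {..<1} = {}" using sep[of "{..<1}"] by auto
  have high: "{1<..} \<subseteq> real_values"
    using sep[of "{1<..}"] large_real_value real_values_subset by auto
  have one: "1 \<in> real_values"
  proof -
    have "closure {1::real<..} \<subseteq> real_values" by (rule closure_minimal[OF high closed_real_values])
    then show ?thesis by auto
  qed
  show "real_values = {1..}"
  proof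
    show "real_values \<subseteq> {1..}" using low real_values_subset by force
    show "{1..} \<subseteq> real_values" using high one by (force simp: le_less)
  qed
  show "1 \<notin> interior_values"
  proof
    assume "1 \<in> interior_values"
    \<comment> \<open>Openness would produce values slightly below 1, on the ray already
      excluded.\<close>
    then obtain e where e: "e > 0" "ball 1 e \<subseteq> interior_values"
      using open_interior_values open_contains_ball by blast
    then have "1 - e / 2 \<in> interior_values" by (auto simp: dist_real_def)
    with low e show False by auto
  qed
qed

lemma left_half_solutions:
  shows "\<tau> \<in> left_half \<Longrightarrow> E6_equivariant \<tau> = of_real r \<Longrightarrow> r \<ge> 1"
    and "r \<ge> 1 \<Longrightarrow> \<exists>\<tau>\<in>left_half. E6_equivariant \<tau> = of_real r"
    and "\<tau> \<in> left_half \<Longrightarrow> \<tau>' \<in> left_half \<Longrightarrow> E6_equivariant \<tau> = of_real r \<Longrightarrow>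
      E6_equivariant \<tau>' = of_real r \<Longrightarrow> \<tau> = \<tau>'"
    and "\<tau> \<in> left_half \<Longrightarrow> E6_equivariant \<tau> = of_real r \<Longrightarrow> norm \<tau> = 1 \<longleftrightarrow> r = 1"
proof -
  show "r \<ge> 1" if "\<tau> \<in> left_half" "E6_equivariant \<tau> = of_real r" for \<tau> r
    using real_values_eq(1) that by (auto simp: real_values_def)
  show "\<exists>\<tau>\<in>left_half. E6_equivariant \<tau> = of_real r" if "r \<ge> 1"
    using real_values_eq(1) that by (auto simp: real_values_def)
  show "\<tau> = \<tau>'" if "\<tau> \<in> left_half" "\<tau>' \<in> left_half" "E6_equivariant \<tau> = of_real r" "E6_equivariant \<tau>' = of_real r"
    using that left_half_real_value(1)[of \<tau>] left_half_real_value(1)[of \<tau>'] inj_on_E6_equivariant_box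
    by (auto simp: inj_on_def)
  show "norm \<tau> = 1 \<longleftrightarrow> r = 1" if t: "\<tau> \<in> left_half" "E6_equivariant \<tau> = of_real r"
  proof
    assume r: "r = 1"
    show "norm \<tau> = 1"
    proof (rule ccontr)
      assume "norm \<tau> \<noteq> 1"
      then have "of_real r \<in> E6_equivariant ` open_region"
        by (intro image_eqI[where f = E6_equivariant, OF t(2)[symmetric]] left_half_outside_unit_circle[OF t])
      then have "r \<in> interior_values" by (simp add: interior_values_def)
      with r real_values_eq(2) show False by simp
    qed
  qed (rule left_half_unit_circle_value[OF t])
qed

section \<open>The fundamental domain and its images\<close>

lemma open_upper_half_plane: "open upper_half_plane"
  unfolding upper_half_plane_def by (rule open_halfspace_Im_gt)

lemma boundary_in_H_image:
  assumes "continuous_on upper_half_plane f" "continuous_on upper_half_plane g"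
    and "\<And>z. z \<in> upper_half_plane \<Longrightarrow> f z \<in> upper_half_plane \<and> g (f z) = z"
    and "\<And>z. z \<in> upper_half_plane \<Longrightarrow> g z \<in> upper_half_plane \<and> f (g z) = z"
    and "S \<subseteq> upper_half_plane"
  shows "boundary_in_H (f ` S) = f ` boundary_in_H S"
proof -
  have "homeomorphic_maps (top_of_set upper_half_plane) (top_of_set upper_half_plane) f g"
    using assms by (auto simp: homeomorphic_maps_def)
  then have "homeomorphic_map (top_of_set upper_half_plane) (top_of_set upper_half_plane) f"
    by (metis homeomorphic_map_maps)
  from homeomorphic_map_frontier_of[OF this] assms(5) show ?thesis
    by (simp add: boundary_in_H_def)
qed

text \<open>As the upper half-plane is open, relatively open and open subsets of it coincide, and
  the boundary can be tested in the complex plane.\<close>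

lemma mem_boundary_in_H_iff:
  assumes "S \<subseteq> upper_half_plane" "z \<in> S"
  shows "z \<in> boundary_in_H S \<longleftrightarrow> \<not> (\<exists>T. open T \<and> z \<in> T \<and> T \<subseteq> S)"
proof -
  have "z \<in> top_of_set upper_half_plane closure_of S"
    using closure_of_subset[of S "top_of_set upper_half_plane"] assms by auto
  moreover have "openin (top_of_set upper_half_plane) T \<longleftrightarrow> open T" if "T \<subseteq> S" for T
    using openin_open_eq[OF open_upper_half_plane] that assms(1) by auto
  ultimately show ?thesis unfolding boundary_in_H_def frontier_of_def interior_of_def by auto
qed

lemma fund_domain_subset: "fund_domain \<subseteq> upper_half_plane"
  by (auto simp: fund_domain_def)

lemma left_half_subset_fund_domain: "left_half \<subseteq> fund_domain"
proof
  fix \<tau> assume t: "\<tau> \<in> left_half"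
  have "(Re \<tau>)\<^sup>2 + (Im \<tau>)\<^sup>2 \<le> (Re \<tau> - 1)\<^sup>2 + (Im \<tau>)\<^sup>2"
    using t by (simp add: left_half_def power2_eq_square algebra_simps)
  then have "norm \<tau> \<le> norm (\<tau> - 1)" by (simp add: cmod_def)
  then show "\<tau> \<in> fund_domain" using t by (simp add: left_half_def fund_domain_def upper_half_plane_def)
qed

lemma norm_1_minus_cnj: "norm (1 - cnj \<tau>) = norm (\<tau> - 1)" "norm (1 - cnj \<tau> - 1) = norm \<tau>"
proof -
  have "1 - cnj \<tau> = cnj (1 - \<tau>)" by simp
  then have "norm (1 - cnj \<tau>) = norm (1 - \<tau>)" by (metis complex_mod_cnj)
  then show "norm (1 - cnj \<tau>) = norm (\<tau> - 1)" by (simp add: norm_minus_commute)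
qed simp

lemma reflect_fund_domain: "1 - cnj \<tau> \<in> fund_domain \<longleftrightarrow> \<tau> \<in> fund_domain"
  by (auto simp: fund_domain_def upper_half_plane_def norm_1_minus_cnj)

lemma fund_domain_cases: "\<tau> \<in> fund_domain \<Longrightarrow> \<tau> \<in> left_half \<or> 1 - cnj \<tau> \<in> left_half"
  by (auto simp: fund_domain_def left_half_def upper_half_plane_def norm_1_minus_cnj)

lemma boundary_fund_domain_reflect:
  "1 - cnj \<tau> \<in> boundary_in_H fund_domain \<longleftrightarrow> \<tau> \<in> boundary_in_H fund_domain"
proof -
  let ?\<rho> = "\<lambda>\<tau>. 1 - cnj \<tau>"
  have "?\<rho> ` fund_domain = fund_domain"
  proof
    show "?\<rho> ` fund_domain \<subseteq> fund_domain" by (auto simp: reflect_fund_domain)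
    show "fund_domain \<subseteq> ?\<rho> ` fund_domain"
    proof
      fix \<tau> assume "\<tau> \<in> fund_domain"
      then show "\<tau> \<in> ?\<rho> ` fund_domain"
        by (intro image_eqI[where f = ?\<rho> and x = "?\<rho> \<tau>"]) (auto simp: reflect_fund_domain)
    qed
  qed
  moreover have "boundary_in_H (?\<rho> ` fund_domain) = ?\<rho> ` boundary_in_H fund_domain"
    by (rule boundary_in_H_image[where g = ?\<rho>])
       (use fund_domain_subset in \<open>auto simp: upper_half_plane_def intro!: continuous_intros\<close>)
  ultimately have e: "?\<rho> ` boundary_in_H fund_domain = boundary_in_H fund_domain" by simp
  have imp: "?\<rho> z \<in> boundary_in_H fund_domain" if "z \<in> boundary_in_H fund_domain" for z
    using e that by blast
  show ?thesis using imp[of \<tau>] imp[of "?\<rho> \<tau>"] by auto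
qed

text \<open>The side \<open>Re \<tau> = 0\<close> of \<open>fund_domain\<close> carries no real
  value, and the line \<open>Re \<tau> = 1/2\<close> bounds only the half. What remains is the arc,
  where the value is 1.\<close>

lemma left_half_boundary_iff:
  assumes "\<tau> \<in> left_half" "E6_equivariant \<tau> = of_real r"
  shows "\<tau> \<in> boundary_in_H fund_domain \<longleftrightarrow> r = 1"
proof -
  have F: "\<tau> \<in> fund_domain" using assms(1) left_half_subset_fund_domain by blast
  note iff = mem_boundary_in_H_iff[OF fund_domain_subset F]
  have "\<tau> \<in> boundary_in_H fund_domain \<longleftrightarrow> norm \<tau> = 1"
  proof
    assume b: "\<tau> \<in> boundary_in_H fund_domain"
    show "norm \<tau> = 1"
    proof (rule ccontr)
      assume "norm \<tau> \<noteq> 1"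
      then have "\<tau> \<in> open_region" by (rule left_half_outside_unit_circle[OF assms])
      moreover have "open_region \<subseteq> fund_domain"
        using open_region_subset(1) left_half_subset_fund_domain by blast
      ultimately show False using iff b open_open_region by blast
    qed
  next
    assume n: "norm \<tau> = 1"
    show "\<tau> \<in> boundary_in_H fund_domain"
    proof (subst iff, clarify)
      fix T assume T: "open T" "\<tau> \<in> T" "T \<subseteq> fund_domain"
      then obtain e where e: "e > 0" "ball \<tau> e \<subseteq> T" using open_contains_ball by blast
      \<comment> \<open>Moving from the arc towards 0 by the factor \<open>1 - s\<close> stays
        within the ball but enters the unit disc, hence leaves \<open>fund_domain\<close>.\<close>
      define s where "s = min (e / 2) (1 / 2)"
      have s: "0 < s" "s < e" "s < 1" using e by (auto simp: s_def)
      have "dist \<tau> (of_real (1 - s) * \<tau>) = norm (of_real s * \<tau>)"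
        by (simp add: dist_norm algebra_simps)
      also have "\<dots> < e" using s n by (simp add: norm_mult)
      finally have "of_real (1 - s) * \<tau> \<in> fund_domain" using e T by auto
      then have "1 \<le> norm (of_real (1 - s) * \<tau>)" by (simp add: fund_domain_def)
      also have "\<dots> = 1 - s" using s n by (simp only: norm_mult norm_of_real) simp
      finally show False using s by simp
    qed
  qed
  then show ?thesis using left_half_solutions(4)[OF assms] by simp
qed

section \<open>Counting solutions on the whole fundamental domain\<close>

lemma E6_equivariant_reflect_real:
  assumes "\<tau> \<in> fund_domain"
  shows "E6_equivariant (1 - cnj \<tau>) = of_real (1 - r) \<longleftrightarrow> E6_equivariant \<tau> = of_real r"
proof -
  have "Im \<tau> > 0" using assms by (simp add: fund_domain_def upper_half_plane_def)
  then show ?thesis by (auto simp: E6_equivariant_reflect complex_eq_iff)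
qed

text \<open>The mirror half has the real values \<open>1 - s\<close> with \<open>s \<ge> 1\<close>,
  none of them positive, so it cannot add a solution for \<open>r \<ge> 1\<close>.\<close>

lemma fund_domain_solutions_left:
  assumes "r \<ge> 1"
  shows "\<exists>!\<tau>. \<tau> \<in> fund_domain \<and> E6_equivariant \<tau> = of_real r"
    and "\<tau> \<in> fund_domain \<Longrightarrow> E6_equivariant \<tau> = of_real r \<Longrightarrow> \<tau> \<in> left_half"
proof -
  show l: "\<tau> \<in> left_half" if "\<tau> \<in> fund_domain" "E6_equivariant \<tau> = of_real r" for \<tau>
  proof (rule ccontr)
    assume "\<tau> \<notin> left_half"
    then have "1 - cnj \<tau> \<in> left_half" using fund_domain_cases that by blast
    then have "1 - r \<ge> 1"
      using left_half_solutions(1) E6_equivariant_reflect_real[OF that(1)] that(2) by blast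
    with assms show False by simp
  qed
  obtain \<tau> where t: "\<tau> \<in> left_half" "E6_equivariant \<tau> = of_real r"
    using left_half_solutions(2)[OF assms] by blast
  show "\<exists>!\<tau>. \<tau> \<in> fund_domain \<and> E6_equivariant \<tau> = of_real r"
  proof (rule ex1I[of _ \<tau>])
    show "\<tau> \<in> fund_domain \<and> E6_equivariant \<tau> = of_real r"
      using t left_half_subset_fund_domain by blast
    show "\<tau>' = \<tau>" if "\<tau>' \<in> fund_domain \<and> E6_equivariant \<tau>' = of_real r" for \<tau>'
      using left_half_solutions(3)[OF l t(1)] that t(2) by blast
  qed
qed

text \<open>The reflection replaces \<open>r\<close> by \<open>1 - r\<close>: it maps the open
  interval from 0 to 1 to itself and exchanges \<open>r \<le> 0\<close> with
  \<open>r \<ge> 1\<close>, so that 0 is the counterpart of the boundary value 1.\<close>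

lemma fund_domain_solutions:
  shows "0 < r \<Longrightarrow> r < 1 \<Longrightarrow> \<tau> \<in> fund_domain \<Longrightarrow> E6_equivariant \<tau> \<noteq> of_real r"
    and "r \<le> 0 \<or> 1 \<le> r \<Longrightarrow> \<exists>!\<tau>. \<tau> \<in> fund_domain \<and> E6_equivariant \<tau> = of_real r"
    and "r \<le> 0 \<or> 1 \<le> r \<Longrightarrow> \<tau> \<in> fund_domain \<Longrightarrow> E6_equivariant \<tau> = of_real r \<Longrightarrow>
      \<tau> \<in> boundary_in_H fund_domain \<longleftrightarrow> r = 0 \<or> r = 1"
proof -
  show "E6_equivariant \<tau> \<noteq> of_real r" if r: "0 < r" "r < 1" and F: "\<tau> \<in> fund_domain"
  proof
    assume e: "E6_equivariant \<tau> = of_real r"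
    then have e': "E6_equivariant (1 - cnj \<tau>) = of_real (1 - r)"
      using E6_equivariant_reflect_real[OF F] by blast
    have "r \<ge> 1 \<or> 1 - r \<ge> 1"
      using fund_domain_cases[OF F] left_half_solutions(1)[OF _ e] left_half_solutions(1)[OF _ e'] by blast
    with r show False by auto
  qed
  have reflect: "\<tau> \<in> fund_domain \<and> E6_equivariant \<tau> = of_real r \<longleftrightarrow>
      1 - cnj \<tau> \<in> fund_domain \<and> E6_equivariant (1 - cnj \<tau>) = of_real (1 - r)" for \<tau>
    using E6_equivariant_reflect_real reflect_fund_domain by blast
  show "\<exists>!\<tau>. \<tau> \<in> fund_domain \<and> E6_equivariant \<tau> = of_real r" if "r \<le> 0 \<or> 1 \<le> r"
    using that
  proof
    assume "r \<le> 0"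
    then have "\<exists>!\<tau>. \<tau> \<in> fund_domain \<and> E6_equivariant \<tau> = of_real (1 - r)"
      by (intro fund_domain_solutions_left) simp
    then obtain \<tau> where t: "\<tau> \<in> fund_domain \<and> E6_equivariant \<tau> = of_real (1 - r)"
      and u: "\<And>\<tau>'. \<tau>' \<in> fund_domain \<and> E6_equivariant \<tau>' = of_real (1 - r) \<Longrightarrow> \<tau>' = \<tau>" by blast
    show ?thesis
    proof (rule ex1I[of _ "1 - cnj \<tau>"])
      show "1 - cnj \<tau> \<in> fund_domain \<and> E6_equivariant (1 - cnj \<tau>) = of_real r"
        using t unfolding reflect[of "1 - cnj \<tau>"] by simp
      show "\<tau>' = 1 - cnj \<tau>" if "\<tau>' \<in> fund_domain \<and> E6_equivariant \<tau>' = of_real r" for \<tau>'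
      proof -
        have "1 - cnj \<tau>' = \<tau>" using that unfolding reflect by (rule u)
        then show ?thesis by auto
      qed
    qed
  qed (rule fund_domain_solutions_left)
  show "\<tau> \<in> boundary_in_H fund_domain \<longleftrightarrow> r = 0 \<or> r = 1"
    if r: "r \<le> 0 \<or> 1 \<le> r" and t: "\<tau> \<in> fund_domain" "E6_equivariant \<tau> = of_real r"
    using r
  proof
    assume r: "1 \<le> r"
    show ?thesis
      using left_half_boundary_iff[OF fund_domain_solutions_left(2)[OF r t] t(2)] r by auto
  next
    assume r: "r \<le> 0"
    then have r': "1 \<le> 1 - r" by simp
    have t': "1 - cnj \<tau> \<in> fund_domain" "E6_equivariant (1 - cnj \<tau>) = of_real (1 - r)"
      using reflect t by blast+
    show ?thesis
      using left_half_boundary_iff[OF fund_domain_solutions_left(2)[OF r' t'] t'(2)] r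
      by (auto simp: boundary_fund_domain_reflect)
  qed
qed

lemma fund_domain_norm_nome:
  assumes "\<tau> \<in> fund_domain"
  shows "norm (nome \<tau>) \<le> 1 / 220"
proof -
  have "Im \<tau> \<ge> 433 / 500"
    using fund_domain_cases[OF assms] left_half_Im_ge[of \<tau>] left_half_Im_ge[of "1 - cnj \<tau>"] by auto
  then show ?thesis using exp_ge_220 norm_nome_le_iff[of 220 \<tau>] by simp
qed

section \<open>Transport by a modular matrix\<close>

lemma modular_act_inverse:
  fixes a b c d :: int
  assumes "a * d - b * c = 1" "Im \<tau> > 0"
  shows "modular_act d (- b) (- c) a (modular_act a b c d \<tau>) = \<tau>"
proof -
  have "complex_of_int a * of_int d - of_int b * of_int c = 1"
    using assms(1) by (metis of_int_1 of_int_diff of_int_mult)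
  then have "complex_of_int a * of_int d \<noteq> of_int b * of_int c" by auto
  then show ?thesis
    using moebius_inverse[OF _ modular_denominator_nonzero[OF assms]]
    by (simp add: modular_act_def)
qed

lemma boundary_modular_act:
  fixes a b c d :: int
  assumes det: "a * d - b * c = 1" and "S \<subseteq> upper_half_plane"
  shows "boundary_in_H (modular_act a b c d ` S) = modular_act a b c d ` boundary_in_H S"
proof (rule boundary_in_H_image[where g = "modular_act d (- b) (- c) a"])
  have cont: "continuous_on upper_half_plane (modular_act a b c d)" if "a * d - b * c = 1" for a b c d
    by (rule continuous_at_imp_continuous_on)
       (use DERIV_isCont[OF has_field_derivative_modular_act[OF that]] in \<open>auto simp: upper_half_plane_def\<close>)
  have det': "d * a - (- b) * (- c) = 1" using det by (simp add: mult.commute)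
  show "continuous_on upper_half_plane (modular_act a b c d)"
    "continuous_on upper_half_plane (modular_act d (- b) (- c) a)"
    by (rule cont[OF det], rule cont[OF det'])
  show "modular_act a b c d z \<in> upper_half_plane \<and> modular_act d (- b) (- c) a (modular_act a b c d z) = z"
    if "z \<in> upper_half_plane" for z
    using that Im_modular_act[OF det] modular_act_inverse[OF det] by (simp add: upper_half_plane_def)
  show "modular_act d (- b) (- c) a z \<in> upper_half_plane \<and> modular_act a b c d (modular_act d (- b) (- c) a z) = z"
    if "z \<in> upper_half_plane" for z
    using that Im_modular_act[OF det'] modular_act_inverse[OF det'] by (simp add: upper_half_plane_def)
qed (rule assms)

theorem theorem1p6:
  fixes a b c d :: int
  assumes "a * d - b * c = 1"
  shows "(neg_d_over_c c d \<in> {0<..<1} \<union> {\<infinity>} \<longrightarrow>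
            \<not> (\<exists>z \<in> modular_act a b c d ` fund_domain. E6_critical_point z))
       \<and> (neg_d_over_c c d \<in> {-\<infinity><..0} \<union> {1..<\<infinity>} \<longrightarrow>
            (\<exists>!z. z \<in> modular_act a b c d ` fund_domain \<and> E6_critical_point z)
          \<and> boundary_in_H (modular_act a b c d ` fund_domain)
              = modular_act a b c d ` boundary_in_H fund_domain
          \<and> (\<forall>z \<in> modular_act a b c d ` fund_domain. E6_critical_point z \<longrightarrow>
               (z \<in> boundary_in_H (modular_act a b c d ` fund_domain)
                  \<longleftrightarrow> neg_d_over_c c d \<in> {0, 1})))"
proof (cases "c = 0")
  case True
  then have "d \<noteq> 0" using assms by auto
  then have "\<not> E6_critical_point (modular_act a b c d \<tau>)" if "\<tau> \<in> fund_domain" for \<tau>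
    using E6_critical_point_modular_act_iff[OF assms fund_domain_norm_nome[OF that]] True by simp
  \<comment> \<open>Only the first implication has content: \<open>\<infinity>\<close> lies in
    neither of the intervals of the second.\<close>
  then show ?thesis using True by (auto simp: neg_d_over_c_def)
next
  case False
  define r where "r = - real_of_int d / real_of_int c"
  let ?\<gamma> = "modular_act a b c d"
  have v: "neg_d_over_c c d = ereal r" using False by (simp add: neg_d_over_c_def r_def)
  have mem: "neg_d_over_c c d \<in> {0<..<1} \<union> {\<infinity>} \<longleftrightarrow> 0 < r \<and> r < 1"
    "neg_d_over_c c d \<in> {-\<infinity><..0} \<union> {1..<\<infinity>} \<longleftrightarrow> r \<le> 0 \<or> 1 \<le> r"
    "neg_d_over_c c d \<in> {0, 1} \<longleftrightarrow> r = 0 \<or> r = 1"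
    unfolding v by (auto simp: zero_ereal_def one_ereal_def)
  have crit: "E6_critical_point (?\<gamma> \<tau>) \<longleftrightarrow> E6_equivariant \<tau> = of_real r" if "\<tau> \<in> fund_domain" for \<tau>
  proof -
    have "complex_of_real r = - of_int d / of_int c" by (simp add: r_def)
    moreover have "of_int c * E6_equivariant \<tau> + of_int d = 0 \<longleftrightarrow> E6_equivariant \<tau> = - of_int d / of_int c"
      using False by (auto simp: field_simps eq_neg_iff_add_eq_0)
    ultimately show ?thesis
      using E6_critical_point_modular_act_iff[OF assms fund_domain_norm_nome[OF that]] by simp
  qed
  have inj: "\<tau> = \<tau>'" if "\<tau> \<in> upper_half_plane" "\<tau>' \<in> upper_half_plane" "?\<gamma> \<tau> = ?\<gamma> \<tau>'" for \<tau> \<tau>'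
    using that modular_act_inverse[OF assms] unfolding upper_half_plane_def mem_Collect_eq by metis
  have bd: "boundary_in_H (?\<gamma> ` fund_domain) = ?\<gamma> ` boundary_in_H fund_domain"
    by (rule boundary_modular_act[OF assms fund_domain_subset])
  have bdsub: "boundary_in_H fund_domain \<subseteq> upper_half_plane"
    unfolding boundary_in_H_def using frontier_of_subset_topspace by fastforce
  have bdiff: "?\<gamma> \<tau> \<in> ?\<gamma> ` boundary_in_H fund_domain \<longleftrightarrow> \<tau> \<in> boundary_in_H fund_domain"
    if "\<tau> \<in> fund_domain" for \<tau>
    using inj bdsub fund_domain_subset that by blast
  show ?thesis unfolding mem
  proof (intro conjI impI ballI)
    assume "0 < r \<and> r < 1"
    then show "\<not> (\<exists>z \<in> ?\<gamma> ` fund_domain. E6_critical_point z)"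
      using fund_domain_solutions(1) crit by blast
  next
    assume r: "r \<le> 0 \<or> 1 \<le> r"
    obtain \<tau> where t: "\<tau> \<in> fund_domain" "E6_equivariant \<tau> = of_real r"
      and u: "\<And>\<tau>'. \<tau>' \<in> fund_domain \<Longrightarrow> E6_equivariant \<tau>' = of_real r \<Longrightarrow> \<tau>' = \<tau>"
      using fund_domain_solutions(2)[OF r] by blast
    show "\<exists>!z. z \<in> ?\<gamma> ` fund_domain \<and> E6_critical_point z"
      by (rule ex1I[of _ "?\<gamma> \<tau>"]) (use t u crit in blast)+
    show "boundary_in_H (?\<gamma> ` fund_domain) = ?\<gamma> ` boundary_in_H fund_domain" by (rule bd)
    fix z assume z: "z \<in> ?\<gamma> ` fund_domain" "E6_critical_point z"
    then obtain \<tau>' where t': "\<tau>' \<in> fund_domain" "z = ?\<gamma> \<tau>'" by blast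
    then have "E6_equivariant \<tau>' = of_real r" using z(2) crit by simp
    from fund_domain_solutions(3)[OF r t'(1) this]
    show "z \<in> boundary_in_H (?\<gamma> ` fund_domain) \<longleftrightarrow> r = 0 \<or> r = 1"
      unfolding bd t'(2) bdiff[OF t'(1)] .
  qed
qed

end
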